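(* Let $k\ge 1$, let $T_1,\dots,T_k$ be finite trees, each on at least two vertices, and let $G=T_1\square\cdots\square T_k$ be their Cartesian product. Then the eccentricity matrix $\mathcal{E}_G$ of $G$ is invertible if and only if one of the trees $T_1,\dots,T_k$ is a star or $P_4$ and the rest are $P_2$.
   Context: For a connected simple graph $G$, $d_G$ is the graph distance and $e_G(v)=\max\{d_G(u,v):u\in V(G)\}$. The eccentricity matrix $\mathcal{E}_G$ is the real square matrix indexed by $V(G)$ with $(\mathcal{E}_G)_{u,v}=d_G(u,v)$ if $d_G(u,v)=\min\{e_G(u),e_G(v)\}$ and $(\mathcal{E}_G)_{u,v}=0$ otherwise. $P_n$ is the path graph on $n$ vertices. A star $S_n$ ($n\ge 1$) is the tree on $n+1$ vertices in which one vertex (the center) is adjacent to all of the $n$ others and there are no other edges; in particular $P_2=S_1$ and $P_3=S_2$ are stars. In the Cartesian product $G_1\square\cdots\square G_k$, the vertices are the $k$-tuples in $V(G_1)\times\cdots\times V(G_k)$, and two tuples are adjacent iff they differ in exactly one coordinate $i$ and their $i$-th coordinates are adjacent in $G_i$. *)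

theory Defs
  imports "Graph_Theory.Graph_Theory" "Jordan_Normal_Form.Matrix" "HOL-Library.FuncSet"
begin

text \<open>
  Finite simple graphs are represented as in \<^theory>\<open>Graph_Theory.Pair_Digraph\<close>: a finite vertex
  set together with a symmetric irreflexive arc set (\<^locale>\<open>pair_graph\<close>).
\<close>

subsection \<open>Distance and eccentricity matrix\<close>

text \<open>Only meaningful for vertices joined by a walk; the graphs below are connected.\<close>

definition gdist :: "'a pair_pre_digraph \<Rightarrow> 'a \<Rightarrow> 'a \<Rightarrow> nat" where
  "gdist G u v = (LEAST n. \<exists>p. pre_digraph.awalk (with_proj G) u p v \<and> length p = n)"

definition eccentricity :: "'a pair_pre_digraph \<Rightarrow> 'a \<Rightarrow> nat" where
  "eccentricity G v = Max ((\<lambda>u. gdist G u v) ` pverts G)"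

text \<open>
  A matrix indexed by a set \<open>V\<close> is a function of two arguments, of which only the values on
  \<open>V \<times> V\<close> are relevant.
\<close>

definition ecc_matrix :: "'a pair_pre_digraph \<Rightarrow> 'a \<Rightarrow> 'a \<Rightarrow> real" where
  "ecc_matrix G u v =
     (if gdist G u v = min (eccentricity G u) (eccentricity G v) then real (gdist G u v) else 0)"

definition invertible_on :: "'a set \<Rightarrow> ('a \<Rightarrow> 'a \<Rightarrow> real) \<Rightarrow> bool" where
  "invertible_on V A \<longleftrightarrow>
     (\<exists>B. (\<forall>u\<in>V. \<forall>v\<in>V. (\<Sum>w\<in>V. A u w * B w v) = (if u = v then 1 else 0)) \<and>
          (\<forall>u\<in>V. \<forall>v\<in>V. (\<Sum>w\<in>V. B u w * A w v) = (if u = v then 1 else 0)))"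

text \<open>This is the usual notion, for any enumeration of the index set.\<close>

lemma invertible_on_iff_invertible_mat:
  assumes "distinct vs"
  shows "invertible_on (set vs) A \<longleftrightarrow>
    invertible_mat (mat (length vs) (length vs) (\<lambda>(i, j). A (vs ! i) (vs ! j)))"
    (is "?L \<longleftrightarrow> invertible_mat ?A")
proof -
  let ?n = "length vs"
  have sum_vs: "(\<Sum>w\<in>set vs. f w) = (\<Sum>i = 0..<?n. f (vs ! i))" for f :: "'a \<Rightarrow> real"
    using sum.reindex_bij_betw[OF bij_betw_nth[OF assms, of "{0..<?n}"], of "set vs" f]
    by (simp add: atLeast0LessThan)
  have ball_vs: "(\<forall>v\<in>set vs. P v) \<longleftrightarrow> (\<forall>i<?n. P (vs ! i))" for P
    by (auto simp: all_set_conv_all_nth)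
  have inj: "vs ! i = vs ! j \<longleftrightarrow> i = j" if "i < ?n" "j < ?n" for i j
    using assms that nth_eq_iff_index_eq by blast
  show ?thesis
  proof
    assume ?L
    then obtain B where
      AB: "\<forall>u\<in>set vs. \<forall>v\<in>set vs. (\<Sum>w\<in>set vs. A u w * B w v) = (if u = v then 1 else 0)" and
      BA: "\<forall>u\<in>set vs. \<forall>v\<in>set vs. (\<Sum>w\<in>set vs. B u w * A w v) = (if u = v then 1 else 0)"
      unfolding invertible_on_def by blast
    define M where "M = mat ?n ?n (\<lambda>(i, j). B (vs ! i) (vs ! j))"
    have "?A * M = 1\<^sub>m ?n" "M * ?A = 1\<^sub>m ?n"
      using AB BA inj by (auto intro!: eq_matI simp: M_def scalar_prod_def sum_vs ball_vs)
    then show "invertible_mat ?A"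
      by (auto simp: invertible_mat_def inverts_mat_def M_def intro!: exI[of _ M])
  next
    assume "invertible_mat ?A"
    then obtain M where M: "?A * M = 1\<^sub>m ?n" "M * ?A = 1\<^sub>m (dim_row M)"
      by (auto simp: invertible_mat_def inverts_mat_def)
    have dim: "dim_row M = ?n" "dim_col M = ?n"
      using arg_cong[OF M(1), of dim_col] arg_cong[OF M(2), of dim_col] by simp_all
    define B where "B u v = M $$ (THE i. i < ?n \<and> vs ! i = u, THE i. i < ?n \<and> vs ! i = v)" for u v
    have the: "(THE k. k < ?n \<and> vs ! k = vs ! i) = i" if "i < ?n" for i
      using that inj by (intro the_equality) auto
    have B: "B (vs ! i) (vs ! j) = M $$ (i, j)" if "i < ?n" "j < ?n" for i j
      using that by (simp add: B_def the)
    have "(\<Sum>k = 0..<?n. A (vs ! i) (vs ! k) * B (vs ! k) (vs ! j)) = (if i = j then 1 else 0)"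
      if "i < ?n" "j < ?n" for i j
      using arg_cong[OF M(1), of "\<lambda>X. X $$ (i, j)"] that dim by (simp add: scalar_prod_def B)
    moreover have "(\<Sum>k = 0..<?n. B (vs ! i) (vs ! k) * A (vs ! k) (vs ! j)) = (if i = j then 1 else 0)"
      if "i < ?n" "j < ?n" for i j
      using arg_cong[OF M(2), of "\<lambda>X. X $$ (i, j)"] that dim by (simp add: scalar_prod_def B)
    ultimately show ?L
      unfolding invertible_on_def sum_vs ball_vs using inj by (intro exI[of _ B]) simp
  qed
qed


subsection \<open>Trees\<close>

text \<open>
  \<^const>\<open>tree\<close> is not usable here: it is about directed cycles, so that \<open>u, v, u\<close> is a cycle in
  every symmetric digraph with an edge between \<open>u\<close> and \<open>v\<close>. The cycles of an undirected simple
  graph are those of length at least 3.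
\<close>

definition undirected_tree :: "'a pair_pre_digraph \<Rightarrow> bool" where
  "undirected_tree G \<longleftrightarrow> pair_graph G \<and> Digraph_Component.connected (with_proj G) \<and>
     \<not> (\<exists>p. pre_digraph.cycle (with_proj G) p \<and> 3 \<le> length p)"

definition path_graph :: "nat \<Rightarrow> nat pair_pre_digraph" where
  "path_graph n = \<lparr> pverts = {..<n}, parcs = {(i, j). i < n \<and> j < n \<and> (j = Suc i \<or> i = Suc j)} \<rparr>"

text \<open>The center is \<open>0\<close>.\<close>

definition star_graph :: "nat \<Rightarrow> nat pair_pre_digraph" where
  "star_graph n = \<lparr> pverts = {0..n}, parcs = {0} \<times> {1..n} \<union> {1..n} \<times> {0} \<rparr>"

definition is_path :: "nat \<Rightarrow> 'a pair_pre_digraph \<Rightarrow> bool" where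
  "is_path n G \<longleftrightarrow> digraph_iso (with_proj G) (with_proj (path_graph n))"

definition is_star :: "'a pair_pre_digraph \<Rightarrow> bool" where
  "is_star G \<longleftrightarrow> (\<exists>n\<ge>1. digraph_iso (with_proj G) (with_proj (star_graph n)))"


subsection \<open>Cartesian product\<close>

text \<open>
  The factors are \<open>T 0, \<dots>, T (k - 1)\<close>; a \<open>k\<close>-tuple is an extensional function on \<open>{..<k}\<close>.
\<close>

definition cartesian_product :: "nat \<Rightarrow> (nat \<Rightarrow> 'a pair_pre_digraph) \<Rightarrow> (nat \<Rightarrow> 'a) pair_pre_digraph" where
  "cartesian_product k T =
     \<lparr> pverts = (\<Pi>\<^sub>E i\<in>{..<k}. pverts (T i)),
       parcs = {(x, y). x \<in> (\<Pi>\<^sub>E i\<in>{..<k}. pverts (T i)) \<and> y \<in> (\<Pi>\<^sub>E i\<in>{..<k}. pverts (T i)) \<and>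
                  (\<exists>i<k. {j. j < k \<and> x j \<noteq> y j} = {i} \<and> (x i, y i) \<in> parcs (T i))} \<rparr>"

end

theory Submission
  imports Defs "Jordan_Normal_Form.Determinant"
begin

text \<open>
  A vertex farthest from another vertex of a tree is peripheral. Distances and eccentricities in the
  product are sums, so the row of a non-peripheral vertex \<open>x\<close> of \<open>G\<close> is the eccentricity of \<open>x\<close>
  times the indicator of its set of farthest vertices, which is the product of the sets of farthest
  vertices of the coordinates. In a tree of diameter at least 2 these indicators are linearly
  dependent: the first two vertices of a diametral path have the same farthest vertices, unless the
  second one is the center, and then the indicators of its neighbours sum up to a multiple of its own
  indicator. If another factor supplies a non-peripheral coordinate, this yields a kernel vector;
  hence at most one factor is not \<open>P\<^sub>2\<close>. The same argument one step further along the path excludes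
  diameter at least 4, and in diameter 3 two leaves at the same vertex have equal rows. Conversely,
  if all other factors are \<open>P\<^sub>2\<close>, then the matrix is the tensor product of a permutation matrix with
  the eccentricity matrix of the remaining factor whose nonzero entries are shifted by \<open>k - 1\<close>, and
  the latter has trivial kernel.
\<close>

subsection \<open>Tree metrics\<close>

text \<open>Finite trees seen through their distance function alone. \<open>d_step\<close> provides
  geodesics. \<open>unique_step\<close> replaces acyclicity: besides the next vertex on the way to
  \<open>r\<close>, every neighbour of \<open>v\<close> is strictly farther from \<open>r\<close>
  than \<open>v\<close>.\<close>

locale tree_metric =
  fixes V :: "'a set" and d :: "'a \<Rightarrow> 'a \<Rightarrow> nat"
  assumes finite_V: "finite V" and V_ne: "V \<noteq> {}"
    and d_eq_0: "x \<in> V \<Longrightarrow> y \<in> V \<Longrightarrow> d x y = 0 \<longleftrightarrow> x = y"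
    and d_commute: "x \<in> V \<Longrightarrow> y \<in> V \<Longrightarrow> d x y = d y x"
    and d_triangle: "x \<in> V \<Longrightarrow> y \<in> V \<Longrightarrow> z \<in> V \<Longrightarrow> d x z \<le> d x y + d y z"
    and d_step: "x \<in> V \<Longrightarrow> y \<in> V \<Longrightarrow> x \<noteq> y \<Longrightarrow> \<exists>z\<in>V. d x z = 1 \<and> d x y = Suc (d z y)"
    and unique_step: "\<lbrakk>r \<in> V; v \<in> V; w \<in> V; w' \<in> V; d v w = 1; d v w' = 1; d w r \<le> d v r; d w' r \<le> d v r\<rbrakk>
      \<Longrightarrow> w = w'"
begin

section \<open>Bipartiteness and the four-point condition\<close>

lemma d_self [simp]: "x \<in> V \<Longrightarrow> d x x = 0"
  by (simp add: d_eq_0)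

text \<open>If \<open>w\<close> were as far from \<open>r\<close> as \<open>v\<close>, it would be a
  non-receding neighbour of \<open>v\<close>, as is the first step \<open>z\<close> of a geodesic
  from \<open>v\<close> to \<open>r\<close>. Then \<open>unique_step\<close> identifies the two,
  although \<open>z\<close> is strictly closer to \<open>r\<close>.\<close>

lemma adjacent_dist:
  assumes "v \<in> V" "w \<in> V" "r \<in> V" "d v w = 1"
  shows "d w r = Suc (d v r) \<or> d v r = Suc (d w r)"
proof -
  have *: "d w r \<noteq> d v r"
  proof
    assume eq: "d w r = d v r"
    have "v \<noteq> r" using eq assms d_eq_0 by force
    then obtain z where z: "z \<in> V" "d v z = 1" "d v r = Suc (d z r)"
      using d_step assms by blast
    then have "z = w" using unique_step[of r v z w] assms eq by auto
    then show False using z eq by auto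
  qed
  have "d w r \<le> d w v + d v r" "d v r \<le> d v w + d w r"
    using d_triangle assms by blast+
  then show ?thesis using * assms d_commute[of v w] by auto
qed

text \<open>Walk \<open>y\<close> along a geodesic to \<open>z\<close>: each step lowers
  \<open>d y z\<close> by one and changes \<open>d x y\<close> by exactly one, so the parity is
  kept. At the end the perimeter is \<open>2 * d x z\<close>.\<close>

lemma even_perimeter:
  assumes "x \<in> V" "y \<in> V" "z \<in> V"
  shows "even (d x y + d y z + d x z)"
  using assms
proof (induction "d y z" arbitrary: y)
  case 0
  then have "y = z" using d_eq_0 by simp
  then show ?case using 0 by simp
next
  case (Suc n)
  have "y \<noteq> z" using Suc.hyps(2) Suc.prems by auto
  then obtain w where w: "w \<in> V" "d y w = 1" "d y z = Suc (d w z)"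
    using d_step Suc.prems by blast
  have "even (d x w + d w z + d x z)" using Suc.hyps Suc.prems w by simp
  moreover have "d w x = Suc (d y x) \<or> d y x = Suc (d w x)"
    using adjacent_dist w Suc.prems by blast
  ultimately show ?case using w d_commute[of x w] d_commute[of x y] Suc.prems by auto
qed

text \<open>Every walk between the two sides of the edge \<open>{x, x'}\<close> uses that edge.\<close>

lemma edge_separates:
  assumes "x \<in> V" "x' \<in> V" "d x x' = 1" "y \<in> V" "z \<in> V"
    and "d x y = Suc (d x' y)" "d x' z = Suc (d x z)"
  shows "d z y = d z x + d x y"
  using assms(5,7)
proof (induction "d z y" arbitrary: z)
  case 0
  then have "z = y" using d_eq_0 assms(4) by simp
  then show ?case using 0 assms(6) by simp
next
  case (Suc n)
  have "z \<noteq> y" using Suc.prems(2) assms(6) by auto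
  then obtain w where w: "w \<in> V" "d z w = 1" "d z y = Suc (d w y)"
    using d_step Suc.prems(1) assms(4) by blast
  note V = assms(1,2,4) Suc.prems(1) w(1)
  show ?case
  proof (cases "d x' w = Suc (d x w)")
    case True
    have "d w y = d w x + d x y" using Suc.hyps True w by auto
    moreover have "d z x \<le> d z w + d w x" "d z y \<le> d z x + d x y"
      using d_triangle V by blast+
    ultimately show ?thesis using w by linarith
  next
    case False
    \<comment> \<open>The step from \<open>z\<close> to \<open>w\<close> changes sides, and this
      forces \<open>w = x'\<close> and \<open>z = x\<close>. Otherwise the next vertex
      \<open>u\<close> from \<open>w\<close> towards \<open>x'\<close> is, like \<open>z\<close>, a
      neighbour of \<open>w\<close> not farther from \<open>x\<close>, so \<open>u = z\<close>; but
      \<open>u\<close> is closer to \<open>x'\<close> than \<open>z\<close> can be.\<close>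
    have c: "d x' z = d z x'" "d x z = d z x" "d x' w = d w x'" "d x w = d w x"
      using V by (simp_all add: d_commute)
    have 1: "d w x = Suc (d w x')"
      using adjacent_dist[of x x' w] V assms(3) False c by auto
    have 2: "d w x = Suc (d z x) \<or> d z x = Suc (d w x)" "d w x' = Suc (d z x') \<or> d z x' = Suc (d w x')"
      using adjacent_dist V w(2) by blast+
    have 3: "d w x = Suc (d z x)" "d w x' = d z x" using 1 2 Suc.prems(2) c by linarith+
    show ?thesis
    proof (cases "w = x'")
      case True
      then have "z = x" using 3(2) d_eq_0 V by simp
      then show ?thesis using V by simp
    next
      case False
      then obtain u where u: "u \<in> V" "d w u = 1" "d w x' = Suc (d u x')"
        using d_step V by blast
      have "d u x \<le> d u x' + d x' x" using d_triangle u(1) V by blast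
      then have "d u x \<le> d w x" using u(3) 1 assms(3) d_commute[of x x'] V by simp
      moreover have "d w z = 1" using w(2) d_commute[of w z] V by simp
      ultimately have "u = z" using unique_step[of x w u z] u V 3(1) by simp
      then show ?thesis using u(3) 3 Suc.prems(2) c by simp
    qed
  qed
qed

text \<open>Move \<open>x\<close> one step towards \<open>y\<close>. If the step also approaches
  \<open>z\<close> and \<open>w\<close>, both sides drop by one. If it moves away from one of them,
  \<open>edge_separates\<close> puts \<open>x\<close> on the geodesic from that vertex to
  \<open>y\<close>, and the triangle inequality finishes.\<close>

lemma four_point:
  assumes "x \<in> V" "y \<in> V" "z \<in> V" "w \<in> V"
  shows "d x y + d z w \<le> max (d x z + d y w) (d x w + d y z)"
  using assms(1)
proof (induction "d x y" arbitrary: x)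
  case 0
  then have "x = y" using d_eq_0 assms(2) by simp
  then show ?case using d_triangle[of z y w] d_commute[of y z] assms(2-4) by simp
next
  case (Suc n)
  have "x \<noteq> y" using Suc.hyps(2) assms(2) by auto
  note V = assms(2-4) Suc.prems
  obtain x' where x': "x' \<in> V" "d x x' = 1" "d x y = Suc (d x' y)"
    using d_step V \<open>x \<noteq> y\<close> by blast
  have IH: "d x' y + d z w \<le> max (d x' z + d y w) (d x' w + d y z)"
    using Suc.hyps x' by simp
  have c: "d y z = d z y" "d y w = d w y" "d z x = d x z" "d w x = d x w" "d w z = d z w"
    using V by (simp_all add: d_commute)
  have tri: "d z w \<le> d z x + d x w" using d_triangle V by blast
  have sep: "d u y = d u x + d x y" if "u \<in> V" "d x' u = Suc (d x u)" for u
    using edge_separates[of x x' y u] that x' V by simp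
  consider "d x z = Suc (d x' z)" "d x w = Suc (d x' w)" | "d z y = d z x + d x y" "d w y = d w x + d x y"
    | "d z y = d z x + d x y" "d x w = Suc (d x' w)" | "d w y = d w x + d x y" "d x z = Suc (d x' z)"
    using adjacent_dist[of x x' z] adjacent_dist[of x x' w] sep[of z] sep[of w] x'(1,2) V
    by metis
  then show ?case
    using x'(3) IH c tri by cases linarith+
qed

section \<open>Eccentricity and diameter in a tree metric\<close>

definition ecc :: "'a \<Rightarrow> nat" where
  "ecc v = Max ((\<lambda>u. d u v) ` V)"

definition diam :: nat where
  "diam = Max (ecc ` V)"

lemma d_le_ecc: "u \<in> V \<Longrightarrow> v \<in> V \<Longrightarrow> d v u \<le> ecc v"
  using finite_V d_commute by (auto simp: ecc_def intro!: Max_ge)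

lemma ecc_attained: "v \<in> V \<Longrightarrow> \<exists>u\<in>V. d v u = ecc v"
  using Max_in[of "(\<lambda>u. d u v) ` V"] finite_V V_ne d_commute by (fastforce simp: ecc_def)

lemma ecc_eqI:
  assumes "v \<in> V" "u \<in> V" "d v u = n" "\<And>u. u \<in> V \<Longrightarrow> d v u \<le> n"
  shows "ecc v = n"
  using assms d_le_ecc ecc_attained by (metis le_antisym)

lemma ecc_le_diam: "v \<in> V \<Longrightarrow> ecc v \<le> diam"
  using finite_V by (auto simp: diam_def intro!: Max_ge)

lemma d_le_diam: "u \<in> V \<Longrightarrow> v \<in> V \<Longrightarrow> d u v \<le> diam"
  using d_le_ecc ecc_le_diam by (meson le_trans)

lemma diam_attained: "\<exists>a\<in>V. \<exists>b\<in>V. d a b = diam"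
proof -
  have "diam \<in> ecc ` V" unfolding diam_def using finite_V V_ne by (intro Max_in) auto
  then show ?thesis using ecc_attained by fastforce
qed

text \<open>Apply \<open>four_point\<close> to a diametral pair \<open>a\<close>, \<open>b\<close>
  and to \<open>x\<close>, \<open>y\<close>. As \<open>d a x\<close> and \<open>d b x\<close> are at
  most \<open>d x y\<close>, this distance cancels and leaves
  \<open>diam \<le> ecc y\<close>.\<close>

lemma ecc_farthest:
  assumes "x \<in> V" "y \<in> V" "d x y = ecc x"
  shows "ecc y = diam"
proof -
  obtain a b where ab: "a \<in> V" "b \<in> V" "d a b = diam" using diam_attained by blast
  have "d a b + d x y \<le> max (d a x + d b y) (d a y + d b x)"
    using four_point ab assms by blast
  moreover have "d a x \<le> d x y" "d b x \<le> d x y" "d a y \<le> ecc y" "d b y \<le> ecc y" "ecc y \<le> diam"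
    using assms ab d_le_ecc d_commute ecc_le_diam by metis+
  ultimately show ?thesis using ab by auto
qed

lemma diametral_point:
  assumes "a \<in> V" "b \<in> V" "d a b = diam" "j \<le> diam"
  shows "\<exists>x\<in>V. d a x = j \<and> d x b = diam - j"
  using assms(4)
proof (induction j)
  case 0
  then show ?case using assms(1-3) by (intro bexI[of _ a]) auto
next
  case (Suc j)
  then obtain x where x: "x \<in> V" "d a x = j" "d x b = diam - j" by auto
  then have "x \<noteq> b" using Suc assms by auto
  then obtain z where z: "z \<in> V" "d x z = 1" "d x b = Suc (d z b)"
    using d_step x assms by blast
  have "d a z \<le> d a x + d x z" "d a b \<le> d a z + d z b" using d_triangle assms x z by blast+
  then show ?case using z x assms Suc by (intro bexI[of _ z]) auto
qed

text \<open>The upper bound is \<open>four_point\<close> for \<open>a\<close>, \<open>b\<close>,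
  \<open>x\<close>, \<open>y\<close>, with the distances from \<open>y\<close> to \<open>a\<close>
  and \<open>b\<close> bounded by the diameter: \<open>d x y\<close> is at most the larger of
  \<open>j\<close> and \<open>diam - j\<close>.\<close>

lemma ecc_diametral_point:
  assumes "a \<in> V" "b \<in> V" "x \<in> V" "d a b = diam" "d a x = j" "d x b = diam - j" "2 * j \<le> diam"
  shows "ecc x = diam - j"
proof (rule ecc_eqI)
  fix y assume y: "y \<in> V"
  have "d a b + d x y \<le> max (d a x + d b y) (d a y + d b x)"
    using four_point y assms by blast
  then show "d x y \<le> diam - j"
    using d_le_diam[of b y] d_le_diam[of a y] assms y d_commute[of x b] by auto
qed (use assms in auto)

text \<open>The dependency is found around the vertex \<open>c\<close> at distance
  \<open>j + 1\<close> from one end of a diametral path. The bound on \<open>ecc\<close> confines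
  its support to non-peripheral vertices once \<open>j\<close> is positive; for \<open>j = 0\<close>
  it says nothing.\<close>

lemma farthest_dependent:
  assumes D: "2 * j + 2 \<le> diam"
  shows "\<exists>z :: 'a \<Rightarrow> real. (\<exists>v\<in>V. z v \<noteq> 0) \<and> (\<forall>v\<in>V. z v \<noteq> 0 \<longrightarrow> ecc v \<le> diam - j) \<and>
    (\<forall>y\<in>V. (\<Sum>v\<in>V. z v * of_bool (d v y = ecc v)) = 0)"
proof -
  obtain a b where ab: "a \<in> V" "b \<in> V" "d a b = diam" using diam_attained by blast
  obtain c where c: "c \<in> V" "d a c = Suc j" "d c b = diam - Suc j"
    using diametral_point[OF ab, of "Suc j"] D by auto
  have ec: "ecc c = diam - Suc j"
    using ecc_diametral_point[OF ab(1,2) c(1) ab(3) c(2,3)] D by auto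
  show ?thesis
  proof (cases "diam = 2 * j + 2")
    case False
    obtain x where x: "x \<in> V" "d a x = j" "d x b = diam - j" "d x c = 1"
    proof -
      have "c \<noteq> a" using c ab by auto
      then obtain x where x: "x \<in> V" "d c x = 1" "d c a = Suc (d x a)"
        using d_step[of c a] ab c by auto
      have "d a b \<le> d a x + d x b" "d x b \<le> d x c + d c b" using d_triangle ab c x by blast+
      then have "d x b = diam - j" using c x ab d_commute D by auto
      then show ?thesis using that[of x] x d_commute ab c by auto
    qed
    have ex: "ecc x = diam - j"
      using ecc_diametral_point[OF ab(1,2) x(1) ab(3) x(2,3)] D by auto
    \<comment> \<open>A vertex farthest from \<open>x\<close> must be farthest from
      \<open>c\<close>, since the distance changes by one. Conversely, if \<open>y\<close> is
      farthest from \<open>c\<close> but closer to \<open>x\<close>, then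
      \<open>d a y \<le> diam - 2\<close>, and \<open>four_point\<close> would give
      \<open>diam \<le> 2 * j + 2\<close>.\<close>
    have iff: "d x y = ecc x \<longleftrightarrow> d c y = ecc c" if y: "y \<in> V" for y
    proof -
      have adj: "d c y = Suc (d x y) \<or> d x y = Suc (d c y)" using adjacent_dist x c y by auto
      have bnd: "d c y \<le> diam - Suc j" "d x y \<le> diam - j" "d b y \<le> diam" using d_le_ecc[of y] y x c ex ec d_le_diam ab by metis+
      have "d a b + d c y \<le> max (d a c + d b y) (d a y + d b c)"
        "d a y \<le> d a x + d x y"
        using four_point d_triangle ab c x y by blast+
      moreover have "d b c = d c b" using d_commute ab c by blast
      ultimately show ?thesis
        using False adj bnd D ex ec c(2,3) ab(3) x(2) by (intro iffI) linarith+
    qed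
    have neq: "x \<noteq> c" using x by auto
    let ?z = "\<lambda>v. if v = x then 1 else if v = c then -1 else (0::real)"
    have "(\<Sum>v\<in>V. ?z v * of_bool (d v y = ecc v)) = 0" if "y \<in> V" for y
    proof -
      have "(\<Sum>v\<in>V. ?z v * of_bool (d v y = ecc v)) = (\<Sum>v\<in>{x,c}. ?z v * of_bool (d v y = ecc v))"
        using finite_V x c by (intro sum.mono_neutral_right) auto
      then show ?thesis using neq iff[OF that] by auto
    qed
    then show ?thesis using x ex ec by (intro exI[of _ ?z]) auto
  next
    case True
    have ec': "ecc c = Suc j" using ec True by auto
    define W where "W = {w \<in> V. d c w = 1}"
    have "finite W" "c \<notin> W" "W \<subseteq> V" using finite_V c by (auto simp: W_def)
    have ew: "ecc w = Suc (Suc j)" if "w \<in> W" for w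
    proof -
      have w: "w \<in> V" "d c w = 1" using that by (auto simp: W_def)
      have "d w y \<le> Suc (Suc j)" if "y \<in> V" for y
        using adjacent_dist[of c w y] d_le_ecc[of y c] w c that ec' by auto
      \<comment> \<open>A neighbour \<open>w\<close> of the center cannot be closer than
        \<open>c\<close> to both ends of the diameter.\<close>
      moreover have "d w a = Suc (Suc j) \<or> d w b = Suc (Suc j)"
        using adjacent_dist[of c w a] adjacent_dist[of c w b] w c ab d_triangle[of a w b] True
          d_commute[of a c] d_commute[of a w]
        by auto
      ultimately show ?thesis using ecc_eqI w ab by metis
    qed
    have "W \<noteq> {}" using d_step[of c a] c ab by (force simp: W_def)
    \<comment> \<open>A vertex farthest from the center \<open>c\<close> is farthest from every
      neighbour of \<open>c\<close> except the one towards it; no other vertex is farthest from a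
      neighbour. So the indicators of the neighbours add up to \<open>card W - 1\<close> times that
      of \<open>c\<close>.\<close>
    let ?z = "\<lambda>v. if v \<in> W then 1 else if v = c then 1 - real (card W) else (0::real)"
    have "(\<Sum>v\<in>V. ?z v * of_bool (d v y = ecc v)) = 0" if y: "y \<in> V" for y
    proof -
      have "(\<Sum>v\<in>V. ?z v * of_bool (d v y = ecc v)) = (\<Sum>v\<in>insert c W. ?z v * of_bool (d v y = ecc v))"
        using finite_V c by (intro sum.mono_neutral_right) (auto simp: W_def)
      also have "\<dots> = (1 - real (card W)) * of_bool (d c y = ecc c) + (\<Sum>v\<in>W. of_bool (d v y = ecc v))"
        using \<open>finite W\<close> \<open>c \<notin> W\<close> by (auto intro!: sum.cong)
      also have "\<dots> = 0"
      proof (cases "d c y = Suc j")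
        case True
        then have "c \<noteq> y" using y by auto
        then obtain u where u: "u \<in> V" "d c u = 1" "d c y = Suc (d u y)"
          using d_step c y by blast
        have uW: "u \<in> W" using u by (auto simp: W_def)
        have "d v y = ecc v \<longleftrightarrow> v \<noteq> u" if "v \<in> W" for v
        proof -
          have v: "v \<in> V" "d c v = 1" using that by (auto simp: W_def)
          show ?thesis
            using adjacent_dist[of c v y] unique_step[of y c v u] v u c y True ew[OF that] by auto
        qed
        then have "(\<Sum>v\<in>W. of_bool (d v y = ecc v)) = (\<Sum>v\<in>W. of_bool (v \<noteq> u) :: real)"
          by (intro sum.cong) auto
        also have "\<dots> = real (card (W - {u}))"
          using \<open>finite W\<close> by (simp add: of_bool_def sum.If_cases Int_def set_diff_eq)
        also have "\<dots> = real (card W) - 1"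
          using uW \<open>finite W\<close> \<open>W \<noteq> {}\<close> by (simp add: of_nat_diff Suc_le_eq card_gt_0_iff)
        finally show ?thesis using True ec' by simp
      next
        case False
        then have "d c y < Suc j" using d_le_ecc[of y c] c y ec' by auto
        then have "d v y \<noteq> ecc v" if "v \<in> W" for v
          using adjacent_dist[of c v y] that c y ew[OF that] by (auto simp: W_def)
        then show ?thesis using False ec' by simp
      qed
      finally show ?thesis .
    qed
    moreover obtain w where "w \<in> W" using \<open>W \<noteq> {}\<close> by blast
    then have "\<exists>v\<in>V. ?z v \<noteq> 0" using \<open>W \<subseteq> V\<close> by (intro bexI[of _ w]) auto
    moreover have "ecc v \<le> diam - j" if "?z v \<noteq> 0" for v
      using that ew[of v] ec' True by (auto split: if_splits)
    ultimately show ?thesis by (intro exI[of _ ?z]) blast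
  qed
qed

section \<open>Trees of small diameter\<close>

lemma two_le_diam:
  assumes "3 \<le> card V"
  shows "2 \<le> diam"
proof (rule ccontr)
  assume "\<not> 2 \<le> diam"
  then have le1: "d x y \<le> 1" if "x \<in> V" "y \<in> V" for x y
    using d_le_diam[OF that] by linarith
  obtain S where "S \<subseteq> V" "card S = 3" using assms by (meson obtain_subset_with_card_n)
  then obtain x y z where S: "S = {x,y,z}" and "x \<noteq> y" "y \<noteq> z" "x \<noteq> z" by (auto simp: card_3_iff)
  with \<open>S \<subseteq> V\<close> have "d x y = 1" "d y z = 1" "d x z = 1" and V: "x \<in> V" "y \<in> V" "z \<in> V"
    using le1 d_eq_0 by (auto simp: le_Suc_eq)
  \<comment> \<open>Three pairwise adjacent vertices have the odd perimeter 3.\<close>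
  then show False using even_perimeter[OF V] by simp
qed

lemma nonperipheral_exists:
  assumes "2 \<le> diam"
  shows "\<exists>v\<in>V. ecc v < diam"
proof -
  obtain a b where ab: "a \<in> V" "b \<in> V" "d a b = diam" using diam_attained by blast
  obtain c where c: "c \<in> V" "d a c = 1" "d c b = diam - 1"
    using diametral_point[OF ab, of 1] assms by auto
  then show ?thesis
    using ecc_diametral_point[OF ab(1,2) c(1) ab(3) c(2,3)] assms by (intro bexI[of _ c]) auto
qed

lemma star_if_diam_2:
  assumes "diam = 2"
  shows "\<exists>c\<in>V. \<forall>v\<in>V - {c}. d c v = 1"
proof -
  obtain c where c: "c \<in> V" "ecc c < 2" using nonperipheral_exists assms by auto
  then have "d c v = 1" if "v \<in> V - {c}" for v
    using that d_le_ecc[of v c] d_eq_0[of c v] by auto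
  then show ?thesis using c by blast
qed

text \<open>On a diametral path \<open>a\<close>, \<open>b\<close>, \<open>c\<close>,
  \<open>e\<close> the inner vertices have eccentricity 2, so every other vertex hangs at
  \<open>b\<close> or \<open>c\<close>. Two of them at the same place would be twins as in
  \<open>twin\<close>; in the product, invertibility excludes these because they yield equal
  rows.\<close>

lemma path_4_if_diam_3:
  assumes "diam = 3"
    and twin: "\<And>l l'. \<lbrakk>l \<in> V; l' \<in> V; ecc l = 3; ecc l' = 3; d l l' = 2;
      \<And>t. t \<in> V \<Longrightarrow> t \<noteq> l \<Longrightarrow> t \<noteq> l' \<Longrightarrow> d l t = d l' t\<rbrakk> \<Longrightarrow> False"
  shows "\<exists>a b c e. V = {a,b,c,e} \<and> distinct [a,b,c,e] \<and> d a b = 1 \<and> d b c = 1 \<and> d c e = 1 \<and> d a e = 3"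
proof -
  obtain a e where ab: "a \<in> V" "e \<in> V" "d a e = 3" using diam_attained assms by metis
  obtain b where b: "b \<in> V" "d a b = 1" "d b e = 2"
    using diametral_point[of a e 1] ab assms by auto
  have eb: "ecc b = 2" using ecc_diametral_point[of a e b 1] ab b assms by auto
  have "b \<noteq> e" using b by auto
  then obtain c where c: "c \<in> V" "d b c = 1" "d b e = Suc (d c e)" using d_step b ab by blast
  then have ce: "d c e = 1" using b by auto
  have ac: "d a c = 2" using d_triangle[of a c e] d_triangle[of a b c] ab b c by auto
  have ec: "ecc c = 2"
    using ecc_diametral_point[of e a c 1] ab ac ce c assms d_commute by auto
  have kinds: "v = b \<or> v = c \<or> (d b v = 1 \<and> d c v = 2) \<or> (d c v = 1 \<and> d b v = 2)" if v: "v \<in> V" for v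
  proof -
    have "d b v = 0 \<longleftrightarrow> v = b" "d c v = 0 \<longleftrightarrow> v = c" using d_eq_0 v b c by auto
    moreover have "d b v \<le> 2" "d c v \<le> 2" using d_le_ecc v b c eb ec by metis+
    moreover have "d c v = Suc (d b v) \<or> d b v = Suc (d c v)" using adjacent_dist b c v by auto
    ultimately show ?thesis by linarith
  qed
  \<comment> \<open>Stated for an arbitrary edge \<open>u\<close>, \<open>w\<close>, so that it
    serves both ends of the edge from \<open>b\<close> to \<open>c\<close>. The vertex
    \<open>o'\<close> hangs at the other end and gives the leaves at \<open>u\<close> their
    eccentricity 3.\<close>
  have same: "l = l'" if uw: "u \<in> V" "w \<in> V" "d u w = 1" and lV: "l \<in> V" "l' \<in> V" "o' \<in> V"
    and l: "d u l = 1" "d w l = 2" "d u l' = 1" "d w l' = 2" "d w o' = 1" "d u o' = 2"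
    and k: "\<And>v. v \<in> V \<Longrightarrow> v = u \<or> v = w \<or> (d u v = 1 \<and> d w v = 2) \<or> (d w v = 1 \<and> d u v = 2)"
    for u w l l' o'
  proof (rule ccontr)
    assume neq: "l \<noteq> l'"
    have two: "d x y = 2" if "x \<in> V" "y \<in> V" "d u x = 1" "d u y = 1" "x \<noteq> y" for x y
    proof -
      have "even (d x y)" using even_perimeter[of u x y] that uw by simp
      moreover have "d x y \<le> 2" "d x y \<noteq> 0"
        using d_triangle[of x u y] d_eq_0[of x y] d_commute[of u x] that uw by auto
      ultimately show ?thesis by (cases "d x y = 1") auto
    qed
    have three: "d x y = 3" if "x \<in> V" "y \<in> V" "d u x = 1" "d w x = 2" "d w y = 1" "d u y = 2" for x y
    proof -
      have c: "d w u = 1" "d u x = d x u" "d w x = d x w" "d w y = d y w" "d u y = d y u" using d_commute that uw by auto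
      \<comment> \<open>The left side is 4 and the second term of the maximum is 2, so the first
        term, \<open>d x y + 1\<close>, must be at least 4.\<close>
      have "d x w + d y u \<le> max (d x y + d w u) (d x u + d w y)"
        using four_point that uw by blast
      then have "3 \<le> d x y" using that c by auto
      then show ?thesis using d_le_diam[of x y] that assms by auto
    qed
    have e3: "ecc x = 3" if "x \<in> V" "d u x = 1" "d w x = 2" for x
      using ecc_eqI[of x o' 3] three[of x o'] that lV l d_le_diam assms by auto
    have "d l t = d l' t" if t: "t \<in> V" "t \<noteq> l" "t \<noteq> l'" for t
      using k[OF t(1)] two[of l t] two[of l' t] three[of l t] three[of l' t] t l lV uw d_commute by metis
    then show False using twin[of l l'] two[of l l'] neq l lV e3 by auto
  qed
  have kb: "d c a = 2" "d b a = 1" "d b c = 1" "d c b = 1" using d_commute ab b c ac by auto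
  have "V \<subseteq> {a,b,c,e}"
  proof
    fix v assume v: "v \<in> V"
    show "v \<in> {a,b,c,e}"
      using kinds[OF v] same[of b c v a e] same[of c b v e a] kb v ab b c ce kinds by auto
  qed
  then have "V = {a,b,c,e}" using ab b c by auto
  moreover have "distinct [a,b,c,e]" using ab b c ce ac kb by auto
  ultimately show ?thesis using ab b c ce by blast
qed

section \<open>Kernels of the shifted matrices of stars and P_4\<close>

definition shifted_ecc_matrix :: "real \<Rightarrow> 'a \<Rightarrow> 'a \<Rightarrow> real" where
  "shifted_ecc_matrix m s t = (if d s t = min (ecc s) (ecc t) then real (d s t) + m else 0)"

text \<open>The shift \<open>m\<close> is what \<open>m\<close> further factors P_2 with differing
  coordinates add to a distance. The row of the center makes the sum of \<open>f\<close> over the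
  leaves 0. The row of a leaf \<open>v\<close> then reads
  \<open>(1 + m) * f c = (2 + m) * f v\<close>, and summing over the leaves gives
  \<open>f c = 0\<close>.\<close>

lemma star_kernel_trivial:
  assumes c: "c \<in> V" and adj: "\<And>v. v \<in> V - {c} \<Longrightarrow> d c v = 1" and card: "2 \<le> card V" and m: "0 \<le> m"
    and ker: "\<And>s. s \<in> V \<Longrightarrow> (\<Sum>t\<in>V. shifted_ecc_matrix m s t * f t) = 0" and t: "t \<in> V"
  shows "f t = 0"
proof -
  let ?L = "V - {c}" and ?M = "shifted_ecc_matrix m"
  have fin: "finite ?L" using finite_V by simp
  have "card ?L = card V - 1" using c finite_V by simp
  then have L: "?L \<noteq> {}" using card by force
  have adj': "d v c = 1" if "v \<in> ?L" for v using adj[OF that] d_commute[of v c] c that by simp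
  have ec: "ecc c = 1"
  proof -
    obtain v where v: "v \<in> ?L" using L by blast
    have "d c u \<le> 1" if "u \<in> V" for u using adj[of u] d_self[OF c] that by (cases "u = c") auto
    then show ?thesis using ecc_eqI[of c v 1] adj[OF v] v c by simp
  qed
  \<comment> \<open>Only a lower bound, because a single leaf has eccentricity 1. It suffices:
    entries between \<open>c\<close> and a leaf are governed by \<open>ecc c = 1\<close>.\<close>
  have el: "1 \<le> ecc v" if "v \<in> ?L" for v
    using d_le_ecc[of c v] adj'[OF that] c that by simp
  have two: "d v w = 2 \<and> ecc v = 2" if v: "v \<in> ?L" and w: "w \<in> ?L" and "v \<noteq> w" for v w
  proof -
    have le: "d v u \<le> 2" if "u \<in> V" for u
    proof (cases "u = c")
      case False
      then have "d v u \<le> d v c + d c u" "d c u = 1" using d_triangle[of v c u] adj[of u] c v that by auto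
      then show ?thesis using adj'[OF v] by simp
    qed (use adj'[OF v] in simp)
    have "even (d v w)" using even_perimeter[of c v w] adj[OF v] adj[OF w] c v w by simp
    moreover have "d v w \<noteq> 0" using d_eq_0 v w \<open>v \<noteq> w\<close> by blast
    ultimately have "d v w = 2" using le[of w] w by (cases "d v w = 1") auto
    then show ?thesis using ecc_eqI[of v w 2] le v w by simp
  qed
  have Mcc: "?M c c = 0" using ec d_self[OF c] by (simp add: shifted_ecc_matrix_def)
  have Mcl: "?M c v = 1 + m" "?M v c = 1 + m" "?M v v = 0" if "v \<in> ?L" for v
    using ec el[OF that] adj[OF that] adj'[OF that] that by (simp_all add: shifted_ecc_matrix_def)
  have Mll: "?M v w = 2 + m" if "v \<in> ?L" "w \<in> ?L" "v \<noteq> w" for v w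
    using two[OF that] two[OF that(2,1)] that(3) by (auto simp: shifted_ecc_matrix_def)
  have split: "(\<Sum>t\<in>V. ?M s t * f t) = ?M s c * f c + (\<Sum>t\<in>?L. ?M s t * f t)" for s
    using sum.remove[OF finite_V c] by blast
  have "(\<Sum>t\<in>?L. ?M c t * f t) = (\<Sum>t\<in>?L. (1 + m) * f t)"
    using Mcl(1) by (intro sum.cong refl) simp
  then have "(1 + m) * (\<Sum>t\<in>?L. f t) = 0"
    using ker[OF c] split[of c] Mcc by (simp add: sum_distrib_left)
  then have S: "(\<Sum>t\<in>?L. f t) = 0" using m by simp
  have row: "(1 + m) * f c = (2 + m) * f v" if v: "v \<in> ?L" for v
  proof -
    have "(\<Sum>t\<in>?L. ?M v t * f t) = ?M v v * f v + (\<Sum>t\<in>?L - {v}. ?M v t * f t)"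
      using sum.remove[OF fin v] by blast
    also have "(\<Sum>t\<in>?L - {v}. ?M v t * f t) = (\<Sum>t\<in>?L - {v}. (2 + m) * f t)"
      by (intro sum.cong refl) (use Mll[OF v] in auto)
    also have "\<dots> = (2 + m) * ((\<Sum>t\<in>?L. f t) - f v)"
      using sum.remove[OF fin v, of f] by (simp flip: sum_distrib_left)
    finally have "(\<Sum>t\<in>?L. ?M v t * f t) = - ((2 + m) * f v)" using S Mcl(3)[OF v] by simp
    then show ?thesis using ker[of v] split[of v] Mcl(2)[OF v] v by simp
  qed
  have "(\<Sum>v\<in>?L. (1 + m) * f c) = (\<Sum>v\<in>?L. (2 + m) * f v)"
    using row by (intro sum.cong refl)
  also have "\<dots> = 0" using S by (simp flip: sum_distrib_left)
  finally have "real (card ?L) * ((1 + m) * f c) = 0" by (simp only: sum_constant)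
  moreover have "card ?L \<noteq> 0" using L fin by (simp only: card_eq_0_iff) blast
  ultimately have fc: "f c = 0" using m by simp
  show ?thesis
  proof (cases "t = c")
    case False
    then have "(2 + m) * f t = 0" using row[of t] fc t by simp
    then show ?thesis using m by simp
  qed (use fc in simp)
qed

text \<open>The rows of the inner vertices \<open>b\<close> and \<open>c\<close> have a single
  nonzero entry, at \<open>e\<close> and \<open>a\<close> respectively. Once \<open>f\<close>
  vanishes there, the rows of \<open>a\<close> and \<open>e\<close> are left with one entry each, at
  \<open>c\<close> and \<open>b\<close>.\<close>

lemma path_4_kernel_trivial:
  assumes V: "V = {a, b, c, e}" and dist: "distinct [a, b, c, e]"
    and d: "d a b = 1" "d b c = 1" "d c e = 1" "d a e = 3" and m: "0 \<le> m"
    and ker: "\<And>s. s \<in> V \<Longrightarrow> (\<Sum>t\<in>V. shifted_ecc_matrix m s t * f t) = 0" and t: "t \<in> V"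
  shows "f t = 0"
proof -
  let ?M = "shifted_ecc_matrix m"
  have mem: "a \<in> V" "b \<in> V" "c \<in> V" "e \<in> V" using V by auto
  have ac: "d a c = 2" using d_triangle[of a b c] d_triangle[of a c e] mem d by linarith
  have be: "d b e = 2" using d_triangle[of b c e] d_triangle[of a b e] mem d by linarith
  have rev: "d b a = 1" "d c b = 1" "d e c = 1" "d e a = 3" "d c a = 2" "d e b = 2"
    using d ac be mem d_commute by metis+
  have self: "d a a = 0" "d b b = 0" "d c c = 0" "d e e = 0" using mem by simp_all
  have all: "(\<forall>u\<in>V. P u) \<longleftrightarrow> P a \<and> P b \<and> P c \<and> P e" for P by (simp add: V)
  have "\<forall>u\<in>V. d a u \<le> 3" "\<forall>u\<in>V. d b u \<le> 2" "\<forall>u\<in>V. d c u \<le> 2" "\<forall>u\<in>V. d e u \<le> 3"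
    unfolding all using d ac be rev self by simp_all
  then have ecc: "ecc a = 3" "ecc b = 2" "ecc c = 2" "ecc e = 3"
    using ecc_eqI[of a e 3] ecc_eqI[of b e 2] ecc_eqI[of c a 2] ecc_eqI[of e a 3] mem d be rev by blast+
  have sum: "(\<Sum>t\<in>V. g t) = g a + g b + g c + g e" for g :: "'a \<Rightarrow> real"
    using dist by (simp add: V add.assoc)
  have "?M b e * f e = 0" "?M c a * f a = 0"
    using ker[of b] ker[of c] mem unfolding sum by (simp_all add: shifted_ecc_matrix_def ecc d ac be rev self)
  then have 1: "f e = 0" "f a = 0"
    using m by (simp_all add: shifted_ecc_matrix_def ecc be rev)
  have "?M a c * f c = 0" "?M e b * f b = 0"
    using ker[of a] ker[of e] mem 1 unfolding sum by (simp_all add: shifted_ecc_matrix_def ecc d ac be rev self)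
  then have "f c = 0" "f b = 0"
    using m by (simp_all add: shifted_ecc_matrix_def ecc ac rev)
  then show ?thesis using 1 t V by auto
qed

lemma two_vertices:
  assumes "card V = 2" "x \<in> V"
  shows "ecc x = 1" "y \<in> V \<Longrightarrow> d x y = of_bool (x \<noteq> y)" "\<exists>y\<in>V. V = {x, y} \<and> x \<noteq> y"
proof -
  obtain y where V: "V = {x, y}" "x \<noteq> y" using assms by (auto simp: card_2_iff)
  then obtain z where z: "z \<in> V" "d x z = 1" using d_step[of x y] by auto
  then have xy: "d x y = 1" using V d_self[of x] by auto
  show "\<exists>y\<in>V. V = {x, y} \<and> x \<noteq> y" using V by blast
  show 1: "d x y' = of_bool (x \<noteq> y')" if "y' \<in> V" for y' using that V xy by auto
  show "ecc x = 1" using ecc_eqI[of x y 1] xy 1 V by auto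
qed

end


subsection \<open>The metric of an undirected tree\<close>

lemma (in pair_wf_digraph) gdist_le_length:
  assumes "awalk u p v"
  shows "gdist G u v \<le> length p"
  unfolding gdist_def by (rule Least_le) (use assms in blast)

lemma (in pair_wf_digraph) shortest_awalk:
  assumes "awalk u p v"
  shows "\<exists>q. awalk u q v \<and> length q = gdist G u v"
  unfolding gdist_def by (rule LeastI_ex) (use assms in blast)

text \<open>A potential argument: \<open>f\<close> drops by at most one along an arc, so a walk to
  \<open>v\<close> has length at least \<open>f u\<close>; by \<open>desc\<close> it can always drop
  by one, so a walk of that length exists.\<close>

lemma (in pair_wf_digraph) gdist_eqI:
  assumes v: "v \<in> pverts G" and u: "u \<in> pverts G" and "f v = 0"
    and lip: "\<And>x y. (x, y) \<in> parcs G \<Longrightarrow> f x \<le> Suc (f y)"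
    and desc: "\<And>x. x \<in> pverts G \<Longrightarrow> x \<noteq> v \<Longrightarrow> \<exists>y. (x, y) \<in> parcs G \<and> f x = Suc (f y)"
  shows "gdist G u v = f u"
proof -
  have lower: "f x \<le> length p" if "awalk x p v" for x p
    using that
  proof (induction p arbitrary: x)
    case Nil
    then show ?case using \<open>f v = 0\<close> by (simp add: awalk_Nil_iff)
  next
    case (Cons e p)
    then show ?case using lip[of x "snd e"] by (fastforce simp: awalk_Cons_iff)
  qed
  have upper: "\<exists>p. awalk x p v \<and> length p = f x" if "x \<in> pverts G" for x
    using that
  proof (induction "f x" arbitrary: x rule: less_induct)
    case less
    show ?case
    proof (cases "x = v")
      case True
      then show ?thesis using v \<open>f v = 0\<close> by (intro exI[of _ "[]"]) (simp add: awalk_Nil_iff)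
    next
      case False
      then obtain y where y: "(x, y) \<in> parcs G" "f x = Suc (f y)" using desc less by blast
      then obtain p where "awalk y p v" "length p = f y"
        using less wellformed' by (metis lessI)
      then show ?thesis using y by (intro exI[of _ "(x, y) # p"]) (simp add: awalk_Cons_iff)
    qed
  qed
  obtain p where p: "awalk u p v" "length p = f u" using upper u by blast
  obtain q where q: "awalk u q v" "length q = gdist G u v" using shortest_awalk p by blast
  show ?thesis using gdist_le_length[OF p(1)] lower[OF q(1)] p q by simp
qed

section \<open>The graph distance of a connected graph and acyclicity\<close>

locale connected_graph = pair_graph +
  assumes connected: "Digraph_Component.connected (with_proj G)"
begin

lemma awalk_exists:
  assumes "u \<in> pverts G" "v \<in> pverts G"
  shows "\<exists>p. awalk u p v"
proof -
  have "u \<rightarrow>\<^sup>*\<^bsub>mk_symmetric (with_proj G)\<^esub> v"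
    using connected assms unfolding Digraph_Component.connected_def by auto
  then have "u \<rightarrow>\<^sup>*\<^bsub>with_proj G\<^esub> v"
    using reachable_mk_symmetric_eq pair_sym_arcs by blast
  then show ?thesis by (simp add: reachable_awalk)
qed

lemma verts_nonempty: "pverts G \<noteq> {}"
  using connected by (auto simp: Digraph_Component.connected_def strongly_connected_def)

lemma geodesic:
  assumes "u \<in> pverts G" "v \<in> pverts G"
  obtains p where "awalk u p v" "length p = gdist G u v"
  using awalk_exists[OF assms] shortest_awalk by blast

lemma gdist_eq_0:
  assumes "u \<in> pverts G" "v \<in> pverts G"
  shows "gdist G u v = 0 \<longleftrightarrow> u = v"
proof
  assume 0: "gdist G u v = 0"
  obtain p where "awalk u p v" "length p = gdist G u v" using geodesic assms by blast
  then show "u = v" using 0 by (simp add: awalk_Nil_iff)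
next
  assume "u = v"
  then show "gdist G u v = 0" using gdist_le_length[of u "[]" v] assms by (simp add: awalk_Nil_iff)
qed

lemma gdist_commute:
  assumes "u \<in> pverts G" "v \<in> pverts G"
  shows "gdist G u v = gdist G v u"
proof -
  have len: "length (rev_path p) = length p" for p :: "('a \<times> 'a) list" by (induction p) auto
  have *: "gdist G x y \<le> gdist G y x" if xy: "x \<in> pverts G" "y \<in> pverts G" for x y
  proof -
    obtain p where p: "awalk y p x" "length p = gdist G y x" using geodesic xy by blast
    then show ?thesis using gdist_le_length[of x "rev_path p" y] by (simp add: len)
  qed
  show ?thesis using *[of u v] *[of v u] assms by simp
qed

lemma gdist_triangle:
  assumes "u \<in> pverts G" "v \<in> pverts G" "w \<in> pverts G"
  shows "gdist G u w \<le> gdist G u v + gdist G v w"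
proof -
  obtain p q where p: "awalk u p v" "length p = gdist G u v" and q: "awalk v q w" "length q = gdist G v w"
    using geodesic assms by metis
  have "awalk u (p @ q) w" using awalk_appendI p q by blast
  then show ?thesis using gdist_le_length[of u "p @ q" w] p q by simp
qed

lemma gdist_eq_1:
  assumes "u \<in> pverts G" "v \<in> pverts G"
  shows "gdist G u v = 1 \<longleftrightarrow> (u, v) \<in> parcs G"
proof
  assume 1: "gdist G u v = 1"
  obtain p where "awalk u p v" "length p = gdist G u v" using geodesic assms by blast
  with 1 obtain e where "awalk u [e] v" by (auto simp: length_Suc_conv)
  then show "(u, v) \<in> parcs G" by (cases e) (auto simp: awalk_Cons_iff awalk_Nil_iff)
next
  assume uv: "(u, v) \<in> parcs G"
  then have "gdist G u v \<le> 1"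
    using gdist_le_length[of u "[(u, v)]" v] assms by (simp add: awalk_Cons_iff awalk_Nil_iff)
  moreover have "gdist G u v \<noteq> 0" using gdist_eq_0 assms uv no_loops' by blast
  ultimately show "gdist G u v = 1" by simp
qed

lemma gdist_step:
  assumes "u \<in> pverts G" "v \<in> pverts G" "u \<noteq> v"
  shows "\<exists>z\<in>pverts G. gdist G u z = 1 \<and> gdist G u v = Suc (gdist G z v)"
proof -
  obtain p where p: "awalk u p v" "length p = gdist G u v" using geodesic assms by blast
  then obtain e q where pq: "p = e # q" using assms by (cases p) (auto simp: awalk_Nil_iff)
  define z where "z = snd e"
  have z: "(u, z) \<in> parcs G" "awalk z q v" using p pq by (auto simp: awalk_Cons_iff z_def)
  then have zV: "z \<in> pverts G" using wellformed' by blast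
  have "gdist G u z = 1" using gdist_eq_1 z zV assms by blast
  moreover have "gdist G z v \<le> length q" using gdist_le_length z by blast
  ultimately show ?thesis
    using gdist_triangle[of u z v] zV p pq assms by (intro bexI[of _ z]) auto
qed

text \<open>A geodesic, built so as to record that it avoids every vertex other than
  \<open>w\<close> that is at least as far from \<open>r\<close> as \<open>w\<close>.\<close>

lemma descending_walk:
  assumes "w \<in> pverts G" "r \<in> pverts G"
  shows "\<exists>p. awalk w p r \<and> (\<forall>x\<in>set (awalk_verts w p). x = w \<or> gdist G x r < gdist G w r)"
  using assms(1)
proof (induction "gdist G w r" arbitrary: w)
  case 0
  then have "w = r" using gdist_eq_0 assms(2) by simp
  then show ?case using assms(2) by (intro exI[of _ "[]"]) (simp add: awalk_Nil_iff)
next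
  case (Suc n)
  then have "w \<noteq> r" using gdist_eq_0[of r r] assms(2) by auto
  then obtain z where z: "z \<in> pverts G" "gdist G w z = 1" "gdist G w r = Suc (gdist G z r)"
    using gdist_step Suc.prems assms(2) by blast
  obtain p where p: "awalk z p r" "\<forall>x\<in>set (awalk_verts z p). x = z \<or> gdist G x r < gdist G z r"
    using Suc.hyps z by (metis Suc_inject)
  have "(w, z) \<in> parcs G" using gdist_eq_1 z Suc.prems by blast
  then show ?case using p z(3) by (intro exI[of _ "(w, z) # p"]) (auto simp: awalk_Cons_iff)
qed

text \<open>Descending walks from \<open>w\<close> and \<open>w'\<close> to \<open>r\<close> both
  avoid \<open>v\<close>. Joined at \<open>r\<close> and shortened to a path from \<open>w\<close>
  to \<open>w'\<close>, they close up through \<open>v\<close> to a cycle; as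
  \<open>w \<noteq> w'\<close>, the path has an arc and the cycle has length at least 3.\<close>

lemma unique_step_if_acyclic:
  assumes acyclic: "\<not> (\<exists>p. cycle p \<and> 3 \<le> length p)"
    and V: "r \<in> pverts G" "v \<in> pverts G" "w \<in> pverts G" "w' \<in> pverts G"
    and adj: "gdist G v w = 1" "gdist G v w' = 1"
    and le: "gdist G w r \<le> gdist G v r" "gdist G w' r \<le> gdist G v r"
  shows "w = w'"
proof (rule ccontr)
  assume neq: "w \<noteq> w'"
  have arcs: "(v, w) \<in> parcs G" "(v, w') \<in> parcs G" using gdist_eq_1 adj V by blast+
  then have "v \<noteq> w" "v \<noteq> w'" using no_loops' by blast+
  obtain p p' where p: "awalk w p r" "\<forall>x\<in>set (awalk_verts w p). x = w \<or> gdist G x r < gdist G w r"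
    and p': "awalk w' p' r" "\<forall>x\<in>set (awalk_verts w' p'). x = w' \<or> gdist G x r < gdist G w' r"
    using descending_walk V by metis
  let ?q = "p @ rev_path p'"
  have q: "awalk w ?q w'" using awalk_appendI[of w p r "rev_path p'" w'] p(1) p'(1) by simp
  \<comment> \<open>\<open>v\<close> differs from both starting vertices and is not closer to
    \<open>r\<close> than either.\<close>
  have "v \<notin> set (awalk_verts w p)" "v \<notin> set (awalk_verts w' p')"
    using p(2) p'(2) le \<open>v \<noteq> w\<close> \<open>v \<noteq> w'\<close> by (auto simp: not_less)
  moreover have "set (awalk_verts r (rev_path p')) = set (awalk_verts w' p')"
    using awalk_verts_rev_path[OF p'(1)] by simp
  moreover have "set (awalk_verts w ?q) = set (awalk_verts w p) \<union> set (awalk_verts r (rev_path p'))"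
    using p(1) p'(1) by (intro set_awalk_verts_append) auto
  ultimately have vq: "v \<notin> set (awalk_verts w ?q)" by simp
  define a where "a = awalk_to_apath ?q"
  have a: "apath w a w'" "set a \<subseteq> set ?q"
    using apath_awalk_to_apath[OF q] awalk_to_apath_subset[OF q] by (auto simp: a_def)
  then have aw: "awalk w a w'" "distinct (awalk_verts w a)" by (auto simp: apath_def)
  have "v \<notin> set (awalk_verts w a)"
    using vq a(2) set_awalk_verts[OF aw(1)] set_awalk_verts[OF q] by auto
  have "a \<noteq> []" using aw(1) neq by (auto simp: awalk_Nil_iff)
  let ?c = "(v, w) # a @ [(w', v)]"
  have cw: "awalk w (a @ [(w', v)]) v"
  proof (rule awalk_appendI[OF aw(1)])
    show "awalk w' [(w', v)] v"
      using arcs V by (auto simp: awalk_Cons_iff awalk_Nil_iff intro: arcs_symmetric)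
  qed
  have "awalk v ?c v" using arcs(1) cw by (simp add: awalk_Cons_iff del: awalk_append_iff)
  moreover have "awalk_verts w (a @ [(w', v)]) = awalk_verts w a @ [v]"
    using awalk_verts_append[OF cw] by simp
  then have "distinct (tl (awalk_verts v ?c))"
    using aw(2) \<open>v \<notin> set (awalk_verts w a)\<close> by simp
  ultimately have "cycle ?c" unfolding cycle_def by blast
  moreover have "3 \<le> length ?c" using \<open>a \<noteq> []\<close> by (cases a) auto
  ultimately show False using acyclic by blast
qed

end

lemma undirected_tree_connected_graph: "undirected_tree G \<Longrightarrow> connected_graph G"
  by (simp add: undirected_tree_def connected_graph_def connected_graph_axioms_def)

lemma tree_metric_gdist:
  assumes "undirected_tree G"
  shows "tree_metric (pverts G) (gdist G)"
proof -
  interpret connected_graph G using undirected_tree_connected_graph assms .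
  have acyclic: "\<not> (\<exists>p. cycle p \<and> 3 \<le> length p)" using assms by (simp add: undirected_tree_def)
  show ?thesis
  proof
    show "w = w'" if "r \<in> pverts G" "v \<in> pverts G" "w \<in> pverts G" "w' \<in> pverts G"
      "gdist G v w = 1" "gdist G v w' = 1" "gdist G w r \<le> gdist G v r" "gdist G w' r \<le> gdist G v r"
      for r v w w'
      using unique_step_if_acyclic[OF acyclic that] .
      show "gdist G x y = gdist G y x" if "x \<in> pverts G" "y \<in> pverts G" for x y
      using gdist_commute that .
  qed (simp_all add: pair_finite_verts verts_nonempty gdist_eq_0 gdist_triangle gdist_step del: One_nat_def)
qed

text \<open>A digraph isomorphism consists of separate maps on vertices and arcs. For pair digraphs
  tail and head are the projections, so the arc map is the vertex map applied to both
  components.\<close>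

lemma digraph_iso_with_proj_iff:
  assumes "pair_wf_digraph G" "pair_wf_digraph H"
  shows "digraph_iso (with_proj G) (with_proj H) \<longleftrightarrow>
    (\<exists>f. bij_betw f (pverts G) (pverts H) \<and>
      (\<forall>u\<in>pverts G. \<forall>v\<in>pverts G. (u, v) \<in> parcs G \<longleftrightarrow> (f u, f v) \<in> parcs H))"
    (is "_ \<longleftrightarrow> ?R")
proof
  interpret G: pair_wf_digraph G by fact
  assume "digraph_iso (with_proj G) (with_proj H)"
  then obtain h where h: "G.digraph_isomorphism h" and H: "with_proj H = app_iso h (with_proj G)"
    unfolding digraph_iso_def by blast
  let ?f = "iso_verts h"
  have inj: "inj_on ?f (pverts G)" using h by (simp add: G.digraph_isomorphism_def)
  have verts: "pverts H = ?f ` pverts G" using arg_cong[OF H, of verts] by simp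
  have "tail (with_proj H) = iso_tail h" "head (with_proj H) = iso_head h" by (simp_all add: H)
  then have "iso_arcs h e = (?f (fst e), ?f (snd e))" if "e \<in> parcs G" for e
    using h that by (simp add: G.digraph_isomorphism_def prod_eq_iff)
  then have arcs: "parcs H = (\<lambda>e. (?f (fst e), ?f (snd e))) ` parcs G"
    using arg_cong[OF H, of arcs] by simp
  have "(u, v) \<in> parcs G \<longleftrightarrow> (?f u, ?f v) \<in> parcs H" if "u \<in> pverts G" "v \<in> pverts G" for u v
  proof
    assume "(?f u, ?f v) \<in> parcs H"
    then obtain x y where xy: "(x, y) \<in> parcs G" "?f u = ?f x" "?f v = ?f y" by (auto simp: arcs)
    have "x \<in> pverts G" "y \<in> pverts G" using G.in_arcsD1[OF xy(1)] G.in_arcsD2[OF xy(1)] .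
    then have "x = u" "y = v" using that xy(2,3) inj_onD[OF inj, of u x] inj_onD[OF inj, of v y] by auto
    then show "(u, v) \<in> parcs G" using xy(1) by simp
  next
    assume "(u, v) \<in> parcs G"
    then show "(?f u, ?f v) \<in> parcs H" unfolding arcs by (intro image_eqI[of _ _ "(u, v)"]) simp_all
  qed
  then show ?R using inj verts by (intro exI[of _ ?f]) (simp add: bij_betw_def)
next
  interpret G: pair_wf_digraph G by fact
  interpret H: pair_wf_digraph H by fact
  assume ?R
  then obtain f where f: "bij_betw f (pverts G) (pverts H)"
    and arc: "\<And>u v. u \<in> pverts G \<Longrightarrow> v \<in> pverts G \<Longrightarrow> (u, v) \<in> parcs G \<longleftrightarrow> (f u, f v) \<in> parcs H"
    by blast
  have inj: "inj_on f (pverts G)" and im: "f ` pverts G = pverts H" using f by (auto simp: bij_betw_def)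
  define h where "h = \<lparr>iso_verts = f, iso_arcs = map_prod f f, iso_head = snd, iso_tail = fst\<rparr>"
  have "inj_on (map_prod f f) (parcs G)"
    by (rule inj_on_subset[OF map_prod_inj_on[OF inj inj]]) (use G.wellformed' in auto)
  then have "G.digraph_isomorphism h"
    using inj G.wf_digraph_axioms by (simp add: G.digraph_isomorphism_def h_def)
  moreover have "map_prod f f ` parcs G = parcs H"
  proof
    show "map_prod f f ` parcs G \<subseteq> parcs H"
    proof (rule image_subsetI)
      fix e assume "e \<in> parcs G"
      then show "map_prod f f e \<in> parcs H"
        using arc[of "fst e" "snd e"] G.arc_fst_in_verts G.arc_snd_in_verts
        by (simp add: map_prod_def split_beta)
    qed
    show "parcs H \<subseteq> map_prod f f ` parcs G"
    proof
      fix e assume e: "e \<in> parcs H"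
      obtain x y where xy: "e = (x, y)" by (cases e)
      have "x \<in> f ` pverts G" "y \<in> f ` pverts G"
        using e H.in_arcsD1[of x y] H.in_arcsD2[of x y] unfolding im xy by blast+
      then obtain u v where "u \<in> pverts G" "v \<in> pverts G" "x = f u" "y = f v" by blast
      then show "e \<in> map_prod f f ` parcs G"
        using arc[of u v] e xy by (intro image_eqI[of _ _ "(u, v)"]) simp_all
    qed
  qed
  then have "with_proj H = app_iso h (with_proj G)"
    using im by (simp add: with_proj_def app_iso_def h_def)
  ultimately show "digraph_iso (with_proj G) (with_proj H)" unfolding digraph_iso_def by blast
qed

section \<open>Paths and stars described by distances\<close>

lemma pair_wf_digraph_path_graph: "pair_wf_digraph (path_graph n)"
  by unfold_locales (auto simp: path_graph_def)

lemma pair_wf_digraph_star_graph: "pair_wf_digraph (star_graph n)"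
  by unfold_locales (auto simp: star_graph_def)

locale undirected_tree_graph =
  fixes G :: "'a pair_pre_digraph"
  assumes undirected_tree: "undirected_tree G"
begin

sublocale connected_graph G
  using undirected_tree_connected_graph undirected_tree .

sublocale tm: tree_metric "pverts G" "gdist G"
  using tree_metric_gdist undirected_tree .

lemma is_path_iff:
  "is_path n G \<longleftrightarrow> (\<exists>f. bij_betw f (pverts G) {..<n} \<and>
    (\<forall>u\<in>pverts G. \<forall>v\<in>pverts G. gdist G u v = 1 \<longleftrightarrow> f u = Suc (f v) \<or> f v = Suc (f u)))"
proof -
  have verts: "pverts (path_graph n) = {..<n}" by (simp add: path_graph_def)
  have arcs: "(f u, f v) \<in> parcs (path_graph n) \<longleftrightarrow> f u = Suc (f v) \<or> f v = Suc (f u)"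
    if "bij_betw f (pverts G) {..<n}" "u \<in> pverts G" "v \<in> pverts G" for f u v
    using bij_betwE[OF that(1)] that(2,3) by (auto simp: path_graph_def)
  show ?thesis
    unfolding is_path_def digraph_iso_with_proj_iff[OF pair_wf_digraph_axioms pair_wf_digraph_path_graph] verts
    by (intro ex_cong1 conj_cong ball_cong refl) (use arcs gdist_eq_1 in blast)
qed

lemma is_path_2_iff: "is_path 2 G \<longleftrightarrow> card (pverts G) = 2"
proof
  assume "is_path 2 G"
  then show "card (pverts G) = 2" by (auto simp: is_path_iff dest!: bij_betw_same_card)
next
  assume "card (pverts G) = 2"
  then obtain a b where ab: "pverts G = {a, b}" "a \<noteq> b" by (auto simp: card_2_iff)
  then obtain z where "z \<in> {a, b}" "gdist G a z = 1" using gdist_step[of a b] by auto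
  then have 1: "gdist G a b = 1" "gdist G b a = 1"
    using gdist_eq_0[of a a] gdist_commute[of a b] ab by auto
  have "bij_betw (\<lambda>x. if x = a then 0 else 1) {a, b} {..<2::nat}"
    using ab by (auto simp: bij_betw_def inj_on_def)
  then show "is_path 2 G"
    unfolding is_path_iff using ab 1 gdist_eq_0 by (intro exI[of _ "\<lambda>x. if x = a then 0 else 1"]) auto
qed

text \<open>The end distance 3 takes the place of listing the non-adjacent pairs: by the triangle
  inequality a chord would shorten it.\<close>

lemma is_path_4_iff:
  "is_path 4 G \<longleftrightarrow> (\<exists>a b c e. pverts G = {a, b, c, e} \<and> distinct [a, b, c, e] \<and>
     gdist G a b = 1 \<and> gdist G b c = 1 \<and> gdist G c e = 1 \<and> gdist G a e = 3)"
proof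
  assume "is_path 4 G"
  then obtain f where f: "bij_betw f (pverts G) {..<4}"
    and adj: "\<And>u v. u \<in> pverts G \<Longrightarrow> v \<in> pverts G \<Longrightarrow> gdist G u v = 1 \<longleftrightarrow> f u = Suc (f v) \<or> f v = Suc (f u)"
    by (auto simp: is_path_iff)
  define g where "g = inv_into (pverts G) f"
  have g: "g i \<in> pverts G" "f (g i) = i" if "i < 4" for i
    using bij_betw_imp_surj_on[OF f] that by (auto simp: g_def inv_into_into f_inv_into_f)
  have "pverts G = g ` {..<4}"
    using f bij_betw_imp_surj_on[OF bij_betw_inv_into] unfolding g_def by blast
  also have "{..<4} = {0, 1, 2, 3::nat}" by auto
  finally have V: "pverts G = {g 0, g 1, g 2, g 3}" by simp
  have inj: "g i = g j \<longleftrightarrow> i = j" if "i < 4" "j < 4" for i j using g(2) that by metis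
  have d: "gdist G (g i) (g j) = 1 \<longleftrightarrow> i = Suc j \<or> j = Suc i" if "i < 4" "j < 4" for i j
    using adj g that by metis
  have 1: "gdist G (g 0) (g 1) = 1" "gdist G (g 1) (g 2) = 1" "gdist G (g 2) (g 3) = 1"
    "gdist G (g 0) (g 3) \<noteq> 1" "gdist G (g 0) (g 2) \<noteq> 1"
    by (subst d; simp)+
  have gV: "g 0 \<in> pverts G" "g 1 \<in> pverts G" "g 2 \<in> pverts G" "g 3 \<in> pverts G" using g by auto
  \<comment> \<open>By parity the distance between the ends is odd. It is at most 3 and not 1, hence
    3.\<close>
  have "even (gdist G (g 0) (g 2))" "odd (gdist G (g 0) (g 3))"
    using tm.even_perimeter[OF gV(1,2,3)] tm.even_perimeter[OF gV(1,3,4)] 1 by auto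
  moreover have "gdist G (g 0) (g 2) \<le> 2" "gdist G (g 0) (g 3) \<le> gdist G (g 0) (g 2) + 1"
    using gdist_triangle[OF gV(1,2,3)] gdist_triangle[OF gV(1,3,4)] 1 by auto
  ultimately have "gdist G (g 0) (g 3) = 3" using 1
    by (cases "gdist G (g 0) (g 3) = 2"; cases "gdist G (g 0) (g 3) = 0") auto
  moreover have "distinct [g 0, g 1, g 2, g 3]" by (simp add: inj)
  ultimately show "\<exists>a b c e. pverts G = {a, b, c, e} \<and> distinct [a, b, c, e] \<and>
     gdist G a b = 1 \<and> gdist G b c = 1 \<and> gdist G c e = 1 \<and> gdist G a e = 3"
    using V 1 by blast
next
  assume "\<exists>a b c e. pverts G = {a, b, c, e} \<and> distinct [a, b, c, e] \<and>
     gdist G a b = 1 \<and> gdist G b c = 1 \<and> gdist G c e = 1 \<and> gdist G a e = 3"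
  then obtain a b c e where V: "pverts G = {a, b, c, e}" and dist: "distinct [a, b, c, e]"
    and d: "gdist G a b = 1" "gdist G b c = 1" "gdist G c e = 1" "gdist G a e = 3"
    by blast
  have mem: "a \<in> pverts G" "b \<in> pverts G" "c \<in> pverts G" "e \<in> pverts G" using V by auto
  have far: "gdist G a c \<noteq> 1" "gdist G b e \<noteq> 1"
    using gdist_triangle[of a c e] gdist_triangle[of a b e] mem d by auto
  define f where "f x = (if x = a then 0 else if x = b then 1 else if x = c then 2 else 3::nat)" for x
  have f: "f a = 0" "f b = 1" "f c = 2" "f e = 3" using dist by (auto simp: f_def)
  have "{..<4} = {0, 1, 2, 3::nat}" by auto
  then have "bij_betw f (pverts G) {..<4}"
    using dist f by (auto simp: V bij_betw_def inj_on_def)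
  moreover have "gdist G b a = 1" "gdist G c b = 1" "gdist G e c = 1" "gdist G e a = 3"
    "gdist G c a \<noteq> 1" "gdist G e b \<noteq> 1"
    using mem d far gdist_commute by metis+
  then have "\<forall>u\<in>pverts G. \<forall>v\<in>pverts G. gdist G u v = 1 \<longleftrightarrow> f u = Suc (f v) \<or> f v = Suc (f u)"
    using d far f by (simp add: V tm.d_self[unfolded V])
  ultimately show "is_path 4 G" unfolding is_path_iff by blast
qed

text \<open>Two neighbours of \<open>c\<close> are never adjacent, by \<open>even_perimeter\<close>,
  so adjacency to the center determines all arcs. The cardinality bound corresponds to the star
  having at least one leaf.\<close>

lemma is_star_iff:
  assumes "2 \<le> card (pverts G)"
  shows "is_star G \<longleftrightarrow> (\<exists>c\<in>pverts G. \<forall>v\<in>pverts G - {c}. gdist G c v = 1)"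
proof
  assume "is_star G"
  then obtain n f where "1 \<le> n" and bij: "bij_betw f (pverts G) (pverts (star_graph n))"
    and arc: "\<And>u v. u \<in> pverts G \<Longrightarrow> v \<in> pverts G \<Longrightarrow> (u, v) \<in> parcs G \<longleftrightarrow> (f u, f v) \<in> parcs (star_graph n)"
    unfolding is_star_def digraph_iso_with_proj_iff[OF pair_wf_digraph_axioms pair_wf_digraph_star_graph]
    by blast
  then have f: "bij_betw f (pverts G) {0..n}" by (simp add: star_graph_def)
  have "0 \<in> f ` pverts G" using bij_betw_imp_surj_on[OF f] by simp
  then obtain c where c: "c \<in> pverts G" "f c = 0" by force
  have "gdist G c v = 1" if v: "v \<in> pverts G - {c}" for v
  proof -
    have "f v \<noteq> 0" using inj_onD[OF bij_betw_imp_inj_on[OF f], of v c] v c by auto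
    moreover have "f v \<in> {0..n}" using bij_betwE[OF f] v by blast
    ultimately have "(f c, f v) \<in> parcs (star_graph n)" using c(2) by (simp add: star_graph_def)
    then have "(c, v) \<in> parcs G" using arc[of c v] c v by blast
    then show ?thesis using gdist_eq_1 c v by blast
  qed
  then show "\<exists>c\<in>pverts G. \<forall>v\<in>pverts G - {c}. gdist G c v = 1" using c by blast
next
  assume "\<exists>c\<in>pverts G. \<forall>v\<in>pverts G - {c}. gdist G c v = 1"
  then obtain c where c: "c \<in> pverts G" and adj: "\<And>v. v \<in> pverts G - {c} \<Longrightarrow> gdist G c v = 1" by blast
  define n where "n = card (pverts G - {c})"
  have n: "1 \<le> n" using assms c pair_finite_verts by (simp add: n_def)
  have "\<exists>g. bij_betw g (pverts G - {c}) {1..n}"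
    by (rule finite_same_card_bij) (simp_all add: n_def pair_finite_verts)
  then obtain g where g: "bij_betw g (pverts G - {c}) {1..n}" by blast
  define f where "f = g(c := 0)"
  have fg: "f v = g v" "f v \<in> {1..n}" if "v \<in> pverts G - {c}" for v
    using that bij_betwE[OF g] by (auto simp: f_def)
  have "bij_betw f (pverts G - {c}) {1..n}" using g bij_betw_cong[of "pverts G - {c}" f g] fg(1) by blast
  moreover have "bij_betw f {c} {0}" by (simp add: f_def)
  ultimately have "bij_betw f (pverts G - {c} \<union> {c}) ({1..n} \<union> {0})"
    by (intro bij_betw_combine) auto
  moreover have "pverts G - {c} \<union> {c} = pverts G" "{1..n} \<union> {0} = {0..n}" using c by auto
  ultimately have "bij_betw f (pverts G) (pverts (star_graph n))" by (simp add: star_graph_def)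
  moreover have "(u, v) \<in> parcs G \<longleftrightarrow> (f u, f v) \<in> parcs (star_graph n)"
    if uv: "u \<in> pverts G" "v \<in> pverts G" for u v
  proof (cases "u = c \<or> v = c")
    case False
    then have "gdist G u v \<noteq> 1" using tm.even_perimeter[of c u v] c uv adj by auto
    moreover have "(f u, f v) \<notin> parcs (star_graph n)"
      using False fg(2)[of u] fg(2)[of v] uv by (auto simp: star_graph_def)
    ultimately show ?thesis using uv gdist_eq_1 by blast
  next
    case True
    have "f c = 0" by (simp add: f_def)
    have 1: "gdist G u v = 1" if "u \<noteq> v"
      using True adj[of u] adj[of v] that uv gdist_commute[of u v] by auto
    have "(f u, f v) \<in> parcs (star_graph n)" if "u \<noteq> v"
      using True fg(2)[of u] fg(2)[of v] uv that \<open>f c = 0\<close> by (auto simp: star_graph_def)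
    moreover have "(f u, f v) \<notin> parcs (star_graph n)" if "u = v" using that by (auto simp: star_graph_def)
    ultimately show ?thesis using 1 gdist_eq_1[OF uv] no_loops'[of u v] by blast
  qed
  ultimately show "is_star G"
    unfolding is_star_def digraph_iso_with_proj_iff[OF pair_wf_digraph_axioms pair_wf_digraph_star_graph]
    using n by (intro exI[of _ n] conjI exI[of _ f]) blast+
qed

lemma eccentricity_eq: "eccentricity G v = tm.ecc v"
  by (simp add: eccentricity_def tm.ecc_def)

end


subsection \<open>Invertibility and kernels\<close>

text \<open>A left inverse kills the kernel. Conversely, after enumerating \<open>V\<close>, a
  vanishing determinant would give a nonzero kernel vector, so the determinant is nonzero and an
  inverse exists.\<close>

lemma invertible_on_iff_trivial_kernel:
  assumes "finite V"
  shows "invertible_on V A \<longleftrightarrow> (\<forall>x. (\<forall>u\<in>V. (\<Sum>v\<in>V. A u v * x v) = 0) \<longrightarrow> (\<forall>v\<in>V. x v = 0))"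
proof
  assume "invertible_on V A"
  then obtain B where B: "\<And>u v. u \<in> V \<Longrightarrow> v \<in> V \<Longrightarrow> (\<Sum>w\<in>V. B u w * A w v) = (if u = v then 1 else 0)"
    unfolding invertible_on_def by blast
  show "\<forall>x. (\<forall>u\<in>V. (\<Sum>v\<in>V. A u v * x v) = 0) \<longrightarrow> (\<forall>v\<in>V. x v = 0)"
  proof (intro allI impI ballI)
    fix x u assume ker: "\<forall>u\<in>V. (\<Sum>v\<in>V. A u v * x v) = 0" and u: "u \<in> V"
    have "x u = (\<Sum>v\<in>V. (if u = v then 1 else 0) * x v)"
      using u assms by (simp add: if_distrib[of "\<lambda>c. c * _"] cong: if_cong)
    also have "\<dots> = (\<Sum>v\<in>V. (\<Sum>w\<in>V. B u w * A w v) * x v)"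
      using B u by (intro sum.cong) auto
    also have "\<dots> = (\<Sum>w\<in>V. B u w * (\<Sum>v\<in>V. A w v * x v))"
      unfolding sum_distrib_right sum_distrib_left by (subst sum.swap) (simp add: mult.assoc)
    also have "\<dots> = 0" using ker by simp
    finally show "x u = 0" .
  qed
next
  assume ker: "\<forall>x. (\<forall>u\<in>V. (\<Sum>v\<in>V. A u v * x v) = 0) \<longrightarrow> (\<forall>v\<in>V. x v = 0)"
  obtain vs where vs: "distinct vs" "V = set vs" using finite_distinct_list[OF assms] by blast
  let ?n = "length vs"
  let ?A = "mat ?n ?n (\<lambda>(i, j). A (vs ! i) (vs ! j))"
  have sum_vs: "(\<Sum>w\<in>set vs. f w) = (\<Sum>i = 0..<?n. f (vs ! i))" for f :: "'a \<Rightarrow> real"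
    using sum.reindex_bij_betw[OF bij_betw_nth[OF vs(1), of "{0..<?n}"], of "set vs" f]
    by (simp add: atLeast0LessThan)
  have "det ?A \<noteq> 0"
  proof
    assume "det ?A = 0"
    then obtain y where y: "y \<in> carrier_vec ?n" "y \<noteq> 0\<^sub>v ?n" "?A *\<^sub>v y = 0\<^sub>v ?n"
      using det_0_iff_vec_prod_zero_field[of ?A ?n] by auto
    define x where "x v = y $ (THE i. i < ?n \<and> vs ! i = v)" for v
    have x: "x (vs ! i) = y $ i" if "i < ?n" for i
    proof -
      have "(THE j. j < ?n \<and> vs ! j = vs ! i) = i"
        using that vs(1) by (intro the_equality) (auto simp: nth_eq_iff_index_eq)
      then show ?thesis by (simp add: x_def)
    qed
    have "(\<Sum>v\<in>V. A u v * x v) = 0" if u: "u \<in> V" for u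
    proof -
      obtain i where i: "i < ?n" "u = vs ! i" using u in_set_conv_nth[of u vs] unfolding vs(2) by blast
      have "(\<Sum>v\<in>V. A u v * x v) = (\<Sum>l = 0..<?n. A u (vs ! l) * y $ l)"
        unfolding vs(2) sum_vs by (intro sum.cong refl) (simp add: x)
      also have "\<dots> = (?A *\<^sub>v y) $ i"
        using i y(1) by (simp add: scalar_prod_def)
      also have "\<dots> = 0" unfolding y(3) using i(1) by simp
      finally show ?thesis .
    qed
    then have "x v = 0" if "v \<in> V" for v using ker that by blast
    then have "y $ i = 0" if "i < ?n" for i using x[OF that] that vs(2) by simp
    then have "y = 0\<^sub>v ?n" using y(1) by (intro eq_vecI) auto
    then show False using y(2) by simp
  qed
  then have "?A \<in> Units (ring_mat TYPE(real) ?n ())" by (intro det_non_zero_imp_unit) auto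
  then obtain M where "M \<in> carrier_mat ?n ?n" "M * ?A = 1\<^sub>m ?n" "?A * M = 1\<^sub>m ?n"
    by (auto simp: Units_def ring_mat_simps)
  then have "invertible_mat ?A"
    unfolding invertible_mat_def inverts_mat_def by (intro conjI exI[of _ M]) auto
  then show "invertible_on V A" using invertible_on_iff_invertible_mat[OF vs(1)] vs(2) by blast
qed

text \<open>This turns equality of a distance with an eccentricity in the product into equality in
  every coordinate.\<close>

lemma sum_eq_iff_if_le:
  fixes f g :: "'b \<Rightarrow> nat"
  assumes "finite S" "\<And>i. i \<in> S \<Longrightarrow> f i \<le> g i"
  shows "sum f S = sum g S \<longleftrightarrow> (\<forall>i\<in>S. f i = g i)"
proof
  assume eq: "sum f S = sum g S"
  show "\<forall>i\<in>S. f i = g i"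
  proof (rule ccontr)
    assume "\<not> (\<forall>i\<in>S. f i = g i)"
    then have "\<exists>i\<in>S. f i < g i" using assms(2) by (force simp: le_less)
    then have "sum f S < sum g S" using assms by (intro sum_strict_mono_ex1) auto
    then show False using eq by simp
  qed
qed simp

lemma sum_lessThan_remove: "j < k \<Longrightarrow> (\<Sum>i<k. f i) = f j + (\<Sum>i\<in>{..<k} - {j}. f i)" for f :: "nat \<Rightarrow> nat"
  by (rule sum.remove) simp_all


subsection \<open>Products of trees\<close>

locale tree_product =
  fixes k :: nat and T :: "nat \<Rightarrow> 'a pair_pre_digraph"
  assumes trees: "\<And>i. i < k \<Longrightarrow> undirected_tree (T i)"
    and card_ge_2: "\<And>i. i < k \<Longrightarrow> 2 \<le> card (pverts (T i))"
begin

section \<open>Distances, eccentricities and matrix entries of the product\<close>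

abbreviation "G \<equiv> cartesian_product k T"
abbreviation "d i \<equiv> gdist (T i)"
abbreviation "e i \<equiv> eccentricity (T i)"
abbreviation "D i \<equiv> tree_metric.diam (pverts (T i)) (gdist (T i))"

lemma tree_graph: "i < k \<Longrightarrow> undirected_tree_graph (T i)"
  using trees by unfold_locales

lemma pverts_product: "pverts G = (\<Pi>\<^sub>E i\<in>{..<k}. pverts (T i))"
  by (simp add: cartesian_product_def)

lemma finite_pverts: "finite (pverts G)"
  unfolding pverts_product
  by (intro finite_PiE) (simp_all add: tree_metric.finite_V[OF tree_metric_gdist[OF trees]])

lemma coord: "x \<in> pverts G \<Longrightarrow> i < k \<Longrightarrow> x i \<in> pverts (T i)"
  by (auto simp: pverts_product)

lemma fun_upd_in_pverts:
  "x \<in> pverts G \<Longrightarrow> i < k \<Longrightarrow> t \<in> pverts (T i) \<Longrightarrow> x(i := t) \<in> pverts G"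
  unfolding pverts_product using PiE_fun_upd[of t "\<lambda>i. pverts (T i)" i x "{..<k}"]
  by (simp add: insert_absorb)

lemma pair_wf_digraph_product: "pair_wf_digraph G"
  by (simp add: pair_wf_digraph_def cartesian_product_def split_beta)

text \<open>The sum of the coordinate distances to \<open>y\<close> is a potential as in
  \<open>gdist_eqI\<close>: an arc moves one coordinate by one step, and any coordinate that differs
  from that of \<open>y\<close> can be moved one step closer.\<close>

lemma gdist_product:
  assumes x: "x \<in> pverts G" and y: "y \<in> pverts G"
  shows "gdist G x y = (\<Sum>i<k. d i (x i) (y i))"
proof (rule pair_wf_digraph.gdist_eqI[OF pair_wf_digraph_product y x])
  have m: "tree_metric (pverts (T i)) (d i)" if "i < k" for i
    using tree_metric_gdist trees that by blast
  show "(\<Sum>i<k. d i (y i) (y i)) = 0"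
    using tree_metric.d_self[OF m coord[OF y]] by simp
  show "(\<Sum>i<k. d i (u i) (y i)) \<le> Suc (\<Sum>i<k. d i (v i) (y i))" if "(u, v) \<in> parcs G" for u v
  proof -
    obtain j where uv: "u \<in> pverts G" "v \<in> pverts G"
      and j: "j < k" "{i. i < k \<and> u i \<noteq> v i} = {j}" "(u j, v j) \<in> parcs (T j)"
      using \<open>(u, v) \<in> parcs G\<close> by (auto simp: cartesian_product_def)
    interpret j: undirected_tree_graph "T j" using tree_graph j(1) .
    have "d j (u j) (v j) = 1" using j.gdist_eq_1[OF coord[OF uv(1) j(1)] coord[OF uv(2) j(1)]] j(3) by blast
    then have "d j (u j) (y j) \<le> Suc (d j (v j) (y j))"
      using j.gdist_triangle[OF coord[OF uv(1) j(1)] coord[OF uv(2) j(1)] coord[OF y j(1)]] by linarith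
    moreover have "(\<Sum>i\<in>{..<k} - {j}. d i (u i) (y i)) = (\<Sum>i\<in>{..<k} - {j}. d i (v i) (y i))"
      using j(2) by (intro sum.cong refl) (metis (mono_tags, lifting) DiffE lessThan_iff mem_Collect_eq)
    ultimately show ?thesis by (simp only: sum_lessThan_remove[OF j(1)])
  qed
  show "\<exists>v. (u, v) \<in> parcs G \<and> (\<Sum>i<k. d i (u i) (y i)) = Suc (\<Sum>i<k. d i (v i) (y i))"
    if u: "u \<in> pverts G" "u \<noteq> y" for u
  proof -
    obtain j where j: "j < k" "u j \<noteq> y j"
      using u y by (metis PiE_ext lessThan_iff pverts_product)
    interpret j: undirected_tree_graph "T j" using tree_graph j(1) .
    obtain z where z: "z \<in> pverts (T j)" "d j (u j) z = 1" "d j (u j) (y j) = Suc (d j z (y j))"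
      using j.gdist_step[OF coord[OF u(1) j(1)] coord[OF y j(1)] j(2)] by blast
    have "u j \<noteq> z" using z(3) by auto
    then have "{i. i < k \<and> u i \<noteq> (u(j := z)) i} = {j}" using j(1) by auto
    moreover have "(u j, (u(j := z)) j) \<in> parcs (T j)"
      using j.gdist_eq_1[OF coord[OF u(1) j(1)] z(1)] z(2) by simp
    ultimately have arc: "(u, u(j := z)) \<in> parcs G"
      using u(1) fun_upd_in_pverts[OF u(1) j(1) z(1)] j(1)
      unfolding cartesian_product_def by (auto simp del: fun_upd_apply)
    have "(\<Sum>i\<in>{..<k} - {j}. d i ((u(j := z)) i) (y i)) = (\<Sum>i\<in>{..<k} - {j}. d i (u i) (y i))"
      by (intro sum.cong refl) simp
    then have "(\<Sum>i<k. d i (u i) (y i)) = Suc (\<Sum>i<k. d i ((u(j := z)) i) (y i))"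
      using z(3) by (simp only: sum_lessThan_remove[OF j(1)] fun_upd_same add_Suc)
    then show ?thesis using arc by blast
  qed
qed

lemma d_le_e:
  assumes "i < k" "s \<in> pverts (T i)" "t \<in> pverts (T i)"
  shows "d i s t \<le> e i s" "d i s t \<le> e i t"
proof -
  interpret i: undirected_tree_graph "T i" using tree_graph assms(1) .
  show "d i s t \<le> e i s" "d i s t \<le> e i t"
    using i.tm.d_le_ecc[of t s] i.tm.d_le_ecc[of s t] i.gdist_commute[of s t] assms i.eccentricity_eq by auto
qed

lemma eccentricity_product:
  assumes x: "x \<in> pverts G"
  shows "eccentricity G x = (\<Sum>i<k. e i (x i))"
  unfolding eccentricity_def[of G]
proof (rule Max_eqI)
  show "finite ((\<lambda>u. gdist G u x) ` pverts G)" using finite_pverts by simp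
  show "n \<le> (\<Sum>i<k. e i (x i))" if n: "n \<in> (\<lambda>u. gdist G u x) ` pverts G" for n
  proof -
    obtain u where u: "u \<in> pverts G" "n = gdist G u x" using n by blast
    show ?thesis unfolding u(2) gdist_product[OF u(1) x]
      using d_le_e(2) coord[OF u(1)] coord[OF x] by (intro sum_mono) simp
  qed
  have far: "\<exists>t. t \<in> pverts (T i) \<and> d i t (x i) = e i (x i)" if i: "i < k" for i
  proof -
    interpret i: undirected_tree_graph "T i" using tree_graph i .
    obtain t where "t \<in> pverts (T i)" "d i (x i) t = e i (x i)"
      using i.tm.ecc_attained[OF coord[OF x i]] i.eccentricity_eq by auto
    then show ?thesis using i.gdist_commute[OF coord[OF x i]] by metis
  qed
  \<comment> \<open>Coordinates can be chosen independently, so taking a farthest vertex in each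
    factor attains all the bounds at once.\<close>
  define f where "f i = (SOME t. t \<in> pverts (T i) \<and> d i t (x i) = e i (x i))" for i
  have f: "f i \<in> pverts (T i)" "d i (f i) (x i) = e i (x i)" if "i < k" for i
    using someI_ex[OF far[OF that]] unfolding f_def by blast+
  define u where "u = (\<lambda>i\<in>{..<k}. f i)"
  have u: "u \<in> pverts G" using f(1) by (auto simp: u_def pverts_product)
  have eq: "gdist G u x = (\<Sum>i<k. e i (x i))"
    unfolding gdist_product[OF u x] using f(2) by (intro sum.cong refl) (simp add: u_def)
  show "(\<Sum>i<k. e i (x i)) \<in> (\<lambda>u. gdist G u x) ` pverts G"
    unfolding eq[symmetric] using u by (rule imageI)
qed

lemma ecc_matrix_product:
  assumes u: "u \<in> pverts G" and v: "v \<in> pverts G"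
  shows "ecc_matrix G u v =
    (if (\<forall>i<k. d i (u i) (v i) = e i (u i)) \<or> (\<forall>i<k. d i (u i) (v i) = e i (v i))
     then \<Sum>i<k. real (d i (u i) (v i)) else 0)"
proof -
  let ?d = "\<Sum>i<k. d i (u i) (v i)"
  have le: "d i (u i) (v i) \<le> e i (u i)" "d i (u i) (v i) \<le> e i (v i)" if "i < k" for i
    using d_le_e[OF that coord[OF u that] coord[OF v that]] by auto
  then have "?d \<le> eccentricity G u" "?d \<le> eccentricity G v"
    unfolding eccentricity_product[OF u] eccentricity_product[OF v] by (auto intro!: sum_mono)
  then have "?d = min (eccentricity G u) (eccentricity G v) \<longleftrightarrow> ?d = eccentricity G u \<or> ?d = eccentricity G v"
    by linarith
  also have "\<dots> \<longleftrightarrow> (\<forall>i<k. d i (u i) (v i) = e i (u i)) \<or> (\<forall>i<k. d i (u i) (v i) = e i (v i))"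
    using sum_eq_iff_if_le[of "{..<k}" "\<lambda>i. d i (u i) (v i)" "\<lambda>i. e i (u i)"]
      sum_eq_iff_if_le[of "{..<k}" "\<lambda>i. d i (u i) (v i)" "\<lambda>i. e i (v i)"] le
    by (simp add: eccentricity_product[OF u] eccentricity_product[OF v] Ball_def)
  finally have eq: "?d = min (eccentricity G u) (eccentricity G v) \<longleftrightarrow> \<dots>" .
  have "ecc_matrix G u v = (if ?d = min (eccentricity G u) (eccentricity G v) then real ?d else 0)"
    by (simp only: ecc_matrix_def gdist_product[OF u v])
  then show ?thesis by (simp only: eq of_nat_sum)
qed

lemma ecc_matrix_commute:
  assumes u: "u \<in> pverts G" and v: "v \<in> pverts G"
  shows "ecc_matrix G u v = ecc_matrix G v u"
proof -
  have "d i (u i) (v i) = d i (v i) (u i)" if "i < k" for i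
    using tree_metric.d_commute[OF tree_metric_gdist[OF trees[OF that]] coord[OF u that] coord[OF v that]] .
  then show ?thesis
    unfolding ecc_matrix_product[OF u v] ecc_matrix_product[OF v u]
    by (intro if_cong sum.cong refl) auto
qed

section \<open>Kernel vectors from dependent or equal columns\<close>

text \<open>A vertex farthest from another one is peripheral in every coordinate, so from the side of a
  non-peripheral vertex only one of the two alternatives in \<open>ecc_matrix_product\<close> can occur.\<close>

lemma ecc_matrix_nonperipheral:
  assumes u: "u \<in> pverts G" and v: "v \<in> pverts G" and l: "l < k" "e l (v l) < D l"
  shows "ecc_matrix G u v = real (eccentricity G v) * of_bool (\<forall>i<k. d i (v i) (u i) = e i (v i))"
proof -
  have comm: "d i (u i) (v i) = d i (v i) (u i)" if "i < k" for i
    using tree_metric.d_commute[OF tree_metric_gdist[OF trees[OF that]] coord[OF u that] coord[OF v that]] .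
  interpret l: undirected_tree_graph "T l" using tree_graph l(1) .
  have no: "d l (u l) (v l) \<noteq> e l (u l)"
    using l.tm.ecc_farthest[OF coord[OF u l(1)] coord[OF v l(1)]] l(2) l.eccentricity_eq by auto
  show ?thesis
  proof (cases "\<forall>i<k. d i (u i) (v i) = e i (v i)")
    case True
    then have "\<forall>i<k. d i (v i) (u i) = e i (v i)" using comm by simp
    moreover have "(\<Sum>i<k. d i (u i) (v i)) = (\<Sum>i<k. e i (v i))" using True by (intro sum.cong) auto
    ultimately show ?thesis
      unfolding ecc_matrix_product[OF u v] eccentricity_product[OF v] of_nat_sum[symmetric]
      using True by simp
  next
    case False
    then have "\<not> (\<forall>i<k. d i (v i) (u i) = e i (v i))" using comm by force
    then show ?thesis unfolding ecc_matrix_product[OF u v] using False no l(1) by auto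
  qed
qed

text \<open>The dependency \<open>z\<close> in factor \<open>j\<close> is placed on the line through
  \<open>p\<close> in direction \<open>j\<close>. By \<open>nonper\<close> each vertex of its
  support has a non-peripheral coordinate, so its column is its eccentricity times an indicator that
  splits over the coordinates; dividing by the eccentricity leaves the relation
  \<open>dep\<close>.\<close>

lemma not_invertible_if_dependent:
  assumes j: "j < k" and p: "p \<in> pverts G"
    and t: "t \<in> pverts (T j)" "z t \<noteq> (0::real)"
    and dep: "\<And>s. s \<in> pverts (T j) \<Longrightarrow> (\<Sum>t\<in>pverts (T j). z t * of_bool (d j t s = e j t)) = 0"
    and nonper: "\<And>t. t \<in> pverts (T j) \<Longrightarrow> z t \<noteq> 0 \<Longrightarrow> \<exists>l<k. e l ((p(j := t)) l) < D l"
    and pos: "\<And>t. t \<in> pverts (T j) \<Longrightarrow> e j t > 0"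
  shows "\<not> invertible_on (pverts G) (ecc_matrix G)"
proof
  assume inv: "invertible_on (pverts G) (ecc_matrix G)"
  \<comment> \<open>The condition \<open>v(j := p j) = p\<close> says that \<open>v\<close> lies on
    the line.\<close>
  define x where "x v = (if v(j := p j) = p then z (v j) / real (eccentricity G v) else 0)" for v
  have mem: "p(j := t) \<in> pverts G" if "t \<in> pverts (T j)" for t using fun_upd_in_pverts p j that .
  have pos': "eccentricity G (p(j := t)) > 0" if "t \<in> pverts (T j)" for t
    using pos[OF that] unfolding eccentricity_product[OF mem[OF that]] sum_lessThan_remove[OF j] by simp
  have fib: "v \<in> (\<lambda>t. p(j := t)) ` pverts (T j)" if "v \<in> pverts G" "v(j := p j) = p" for v
  proof -
    have "v = p(j := v j)" by (metis fun_upd_triv fun_upd_upd that(2))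
    then show ?thesis using coord[OF that(1) j] by blast
  qed
  have inj: "inj_on (\<lambda>t. p(j := t)) (pverts (T j))" by (rule inj_onI) (metis fun_upd_same)
  have "(\<Sum>v\<in>pverts G. ecc_matrix G u v * x v) = 0" if u: "u \<in> pverts G" for u
  proof -
    \<comment> \<open>The contribution of the coordinates other than \<open>j\<close>, which is the
      same for all vertices on the line.\<close>
    let ?c = "of_bool (\<forall>i<k. i \<noteq> j \<longrightarrow> d i (p i) (u i) = e i (p i)) :: real"
    have "(\<Sum>v\<in>pverts G. ecc_matrix G u v * x v)
      = (\<Sum>v\<in>(\<lambda>t. p(j := t)) ` pverts (T j). ecc_matrix G u v * x v)"
      using finite_pverts mem fib by (intro sum.mono_neutral_right) (auto simp: x_def)
    also have "\<dots> = (\<Sum>t\<in>pverts (T j). ecc_matrix G u (p(j := t)) * x (p(j := t)))"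
      using sum.reindex[OF inj] by simp
    also have "\<dots> = (\<Sum>t\<in>pverts (T j). ?c * (z t * of_bool (d j t (u j) = e j t)))"
    proof (rule sum.cong)
      fix t assume t: "t \<in> pverts (T j)"
      have x: "x (p(j := t)) = z t / real (eccentricity G (p(j := t)))" by (simp add: x_def)
      show "ecc_matrix G u (p(j := t)) * x (p(j := t)) = ?c * (z t * of_bool (d j t (u j) = e j t))"
      proof (cases "z t = 0")
        case False
        then obtain l where "l < k" "e l ((p(j := t)) l) < D l" using nonper t by blast
        moreover have "(\<forall>i<k. d i ((p(j := t)) i) (u i) = e i ((p(j := t)) i)) \<longleftrightarrow>
          (\<forall>i<k. i \<noteq> j \<longrightarrow> d i (p i) (u i) = e i (p i)) \<and> d j t (u j) = e j t"
          using j by auto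
        ultimately show ?thesis
          using ecc_matrix_nonperipheral[OF u mem[OF t]] pos'[OF t] x by simp
      qed (simp add: x)
    qed simp
    also have "\<dots> = 0" using dep[OF coord[OF u j]] by (simp flip: sum_distrib_left)
    finally show ?thesis .
  qed
  then have "\<forall>v\<in>pverts G. x v = 0"
    using inv unfolding invertible_on_iff_trivial_kernel[OF finite_pverts] by blast
  then have "x (p(j := t)) = 0" using mem t(1) by blast
  then show False using t pos'[OF t(1)] by (simp add: x_def)
qed

text \<open>By symmetry the columns of \<open>u\<close> and \<open>v\<close> agree as well, so the
  difference of the two unit vectors lies in the kernel.\<close>

lemma not_invertible_if_equal_rows:
  assumes uv: "u \<in> pverts G" "v \<in> pverts G" "u \<noteq> v"
    and eq: "\<And>w. w \<in> pverts G \<Longrightarrow> ecc_matrix G u w = ecc_matrix G v w"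
  shows "\<not> invertible_on (pverts G) (ecc_matrix G)"
proof
  assume inv: "invertible_on (pverts G) (ecc_matrix G)"
  let ?x = "\<lambda>w. if w = u then 1 else if w = v then -1 else (0::real)"
  have "(\<Sum>w\<in>pverts G. ecc_matrix G t w * ?x w) = 0" if t: "t \<in> pverts G" for t
  proof -
    have "(\<Sum>w\<in>pverts G. ecc_matrix G t w * ?x w) = (\<Sum>w\<in>{u, v}. ecc_matrix G t w * ?x w)"
    proof (rule sum.mono_neutral_right[OF finite_pverts])
      show "{u, v} \<subseteq> pverts G" using uv(1,2) by blast
    qed simp
    also have "\<dots> = ecc_matrix G t u - ecc_matrix G t v" using uv(3) by simp
    also have "\<dots> = 0"
      unfolding ecc_matrix_commute[OF t uv(1)] ecc_matrix_commute[OF t uv(2)] eq[OF t] by simp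
    finally show ?thesis .
  qed
  then have "?x u = 0"
    using spec[OF inv[unfolded invertible_on_iff_trivial_kernel[OF finite_pverts]], of ?x] uv(1) by blast
  then show False by simp
qed

section \<open>Which factors invertibility permits\<close>

lemma eccentricity_pos:
  assumes "i < k" "t \<in> pverts (T i)"
  shows "0 < e i t"
proof -
  interpret i: undirected_tree_graph "T i" using tree_graph assms(1) .
  have "pverts (T i) \<noteq> {t}" using card_ge_2[OF assms(1)] by auto
  then obtain s where s: "s \<in> pverts (T i)" "s \<noteq> t" using assms(2) by blast
  then have "d i s t \<noteq> 0" using i.gdist_eq_0 assms(2) by blast
  then show ?thesis using d_le_e(2)[OF assms(1) s(1) assms(2)] by simp
qed

lemma pverts_nonempty: "\<exists>p. p \<in> pverts G"
proof -
  have "(SOME v. v \<in> pverts (T i)) \<in> pverts (T i)" if "i < k" for i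
    using card_ge_2[OF that] some_in_eq[of "pverts (T i)"] by auto
  then have "(\<lambda>i\<in>{..<k}. SOME v. v \<in> pverts (T i)) \<in> pverts G"
    unfolding pverts_product by (intro restrict_PiE_iff[THEN iffD2]) simp
  then show ?thesis by blast
qed

text \<open>Factor \<open>i\<close> supplies a non-peripheral coordinate that stays fixed along the
  line, and factor \<open>j\<close> the dependency. Peripheral vertices may therefore occur in its
  support, which is why \<open>farthest_dependent\<close> is used with parameter 0.\<close>

lemma not_invertible_if_two_large_factors:
  assumes i: "i < k" "3 \<le> card (pverts (T i))" and j: "j < k" "3 \<le> card (pverts (T j))" and "i \<noteq> j"
  shows "\<not> invertible_on (pverts G) (ecc_matrix G)"
proof -
  interpret i: undirected_tree_graph "T i" using tree_graph i(1) .
  interpret j: undirected_tree_graph "T j" using tree_graph j(1) .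
  obtain v where v: "v \<in> pverts (T i)" "i.tm.ecc v < i.tm.diam"
    using i.tm.nonperipheral_exists i.tm.two_le_diam i(2) by blast
  obtain p where "p \<in> pverts G" using pverts_nonempty by blast
  then have p: "p(i := v) \<in> pverts G" using fun_upd_in_pverts i(1) v(1) by blast
  obtain z t where t: "t \<in> pverts (T j)" "z t \<noteq> (0::real)"
    and dep: "\<And>y. y \<in> pverts (T j) \<Longrightarrow> (\<Sum>v\<in>pverts (T j). z v * of_bool (d j v y = j.tm.ecc v)) = 0"
    using j.tm.farthest_dependent[of 0] j.tm.two_le_diam[OF j(2)] by auto
  have per: "e i ((p(i := v, j := s)) i) < D i" for s
    using v(2) \<open>i \<noteq> j\<close> by (simp add: i.eccentricity_eq)
  show ?thesis
    using not_invertible_if_dependent[OF j(1) p t dep[folded j.eccentricity_eq]] per i(1)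
      eccentricity_pos[OF j(1)] by blast
qed

text \<open>With parameter 1, \<open>farthest_dependent\<close> needs diameter at least 4 and yields
  a support of non-peripheral vertices of factor \<open>j\<close> itself, so no second factor has to
  help.\<close>

lemma not_invertible_if_large_diameter:
  assumes j: "j < k" "4 \<le> D j"
  shows "\<not> invertible_on (pverts G) (ecc_matrix G)"
proof -
  interpret j: undirected_tree_graph "T j" using tree_graph j(1) .
  obtain p where p: "p \<in> pverts G" using pverts_nonempty by blast
  obtain z t where t: "t \<in> pverts (T j)" "z t \<noteq> (0::real)"
    and supp: "\<And>v. v \<in> pverts (T j) \<Longrightarrow> z v \<noteq> 0 \<Longrightarrow> j.tm.ecc v \<le> D j - 1"
    and dep: "\<And>y. y \<in> pverts (T j) \<Longrightarrow> (\<Sum>v\<in>pverts (T j). z v * of_bool (d j v y = j.tm.ecc v)) = 0"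
    using j.tm.farthest_dependent[of 1] j(2) by auto
  have per: "\<exists>l<k. e l ((p(j := s)) l) < D l" if "s \<in> pverts (T j)" "z s \<noteq> 0" for s
    using supp[OF that] j by (intro exI[of _ j]) (simp add: j.eccentricity_eq)
  show ?thesis
    using not_invertible_if_dependent[OF j(1) p t dep[folded j.eccentricity_eq] per]
      eccentricity_pos[OF j(1)] by blast
qed

lemma is_path_4_if_diameter_3:
  assumes inv: "invertible_on (pverts G) (ecc_matrix G)" and j: "j < k" "D j = 3"
  shows "is_path 4 (T j)"
proof -
  interpret j: undirected_tree_graph "T j" using tree_graph j(1) .
  obtain p where p: "p \<in> pverts G" using pverts_nonempty by blast
  have False if l: "l \<in> pverts (T j)" "l' \<in> pverts (T j)" "j.tm.ecc l = 3" "j.tm.ecc l' = 3" "d j l l' = 2"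
    and twin: "\<And>t. t \<in> pverts (T j) \<Longrightarrow> t \<noteq> l \<Longrightarrow> t \<noteq> l' \<Longrightarrow> d j l t = d j l' t" for l l'
  proof -
    let ?u = "p(j := l)" and ?v = "p(j := l')"
    have mem: "?u \<in> pverts G" "?v \<in> pverts G" using fun_upd_in_pverts p j(1) l by blast+
    have e3: "e j l = 3" "e j l' = 3" using l by (simp_all add: j.eccentricity_eq)
    have neq: "l \<noteq> l'" using l(5) j.tm.d_self[OF l(1)] by auto
    have l'l: "d j l' l = 2" using l j.gdist_commute by metis
    have "ecc_matrix G ?u w = ecc_matrix G ?v w" if w: "w \<in> pverts G" for w
    \<comment> \<open>If \<open>w j\<close> is one of the twins, both entries vanish: coordinate
      \<open>j\<close> has distance at most 2 but eccentricity 3 on both sides. Otherwise all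
      distances and eccentricities agree for \<open>?u\<close> and \<open>?v\<close>.\<close>
    proof (cases "w j \<in> {l, l'}")
      case True
      then have "e j (w j) = 3" "d j l (w j) \<le> 2" "d j l' (w j) \<le> 2"
        using e3 l l'l j.tm.d_self by auto
      then have no: "\<not> (\<forall>i<k. d i (?u i) (w i) = e i (?u i))" "\<not> (\<forall>i<k. d i (?u i) (w i) = e i (w i))"
        "\<not> (\<forall>i<k. d i (?v i) (w i) = e i (?v i))" "\<not> (\<forall>i<k. d i (?v i) (w i) = e i (w i))"
        using j(1) e3 by (auto intro!: exI[of _ j])
      show ?thesis
        unfolding ecc_matrix_product[OF mem(1) w] ecc_matrix_product[OF mem(2) w]
        by (simp only: no simp_thms if_False)
    next
      case False
      have "d j l (w j) = d j l' (w j)" using twin[OF coord[OF w j(1)]] False by blast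
      then have eq: "d i (?u i) (w i) = d i (?v i) (w i)" "e i (?u i) = e i (?v i)" for i
        using e3 by (cases "i = j"; simp)+
      show ?thesis unfolding ecc_matrix_product[OF mem(1) w] ecc_matrix_product[OF mem(2) w] eq ..
    qed
    moreover have "?u \<noteq> ?v" using neq by (metis fun_upd_same)
    ultimately show False using not_invertible_if_equal_rows[OF mem] inv by blast
  qed
  then show ?thesis
    unfolding j.is_path_4_iff using j.tm.path_4_if_diam_3[OF j(2)] by blast
qed

lemma factor_if_invertible:
  assumes inv: "invertible_on (pverts G) (ecc_matrix G)" and j: "j < k"
  shows "is_star (T j) \<or> is_path 4 (T j)"
proof -
  interpret j: undirected_tree_graph "T j" using tree_graph j .
  have "D j < 4" using not_invertible_if_large_diameter[OF j] inv by linarith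
  moreover have "is_star (T j)" if "D j = 2"
    using j.tm.star_if_diam_2[OF that] j.is_star_iff[OF card_ge_2[OF j]] by blast
  \<comment> \<open>Such a tree has only two vertices, and either of them serves as the
    center.\<close>
  moreover have "is_star (T j)" if "D j < 2"
  proof -
    have "card (pverts (T j)) = 2" using j.tm.two_le_diam card_ge_2[OF j] that by linarith
    moreover obtain c where c: "c \<in> pverts (T j)" using j.verts_nonempty by blast
    ultimately have "\<forall>v\<in>pverts (T j) - {c}. d j c v = 1" using j.tm.two_vertices(2) by auto
    then show ?thesis using c j.is_star_iff[OF card_ge_2[OF j]] by blast
  qed
  moreover have "D j < 2 \<or> D j = 2 \<or> D j = 3" using calculation(1) by linarith
  ultimately show ?thesis using is_path_4_if_diameter_3[OF inv j] by blast
qed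

lemma factors_if_invertible:
  assumes inv: "invertible_on (pverts G) (ecc_matrix G)" and k: "1 \<le> k"
  shows "\<exists>i<k. (is_star (T i) \<or> is_path 4 (T i)) \<and> (\<forall>j<k. j \<noteq> i \<longrightarrow> is_path 2 (T j))"
proof -
  have small: "is_path 2 (T j)" if "j < k" "\<not> 3 \<le> card (pverts (T j))" for j
    using undirected_tree_graph.is_path_2_iff[OF tree_graph[OF that(1)]] card_ge_2[OF that(1)] that(2)
    by linarith
  show ?thesis
  proof (cases "\<exists>i<k. 3 \<le> card (pverts (T i))")
    case True
    then obtain i where i: "i < k" "3 \<le> card (pverts (T i))" by blast
    then have "is_path 2 (T j)" if "j < k" "j \<noteq> i" for j
      using small[OF that(1)] not_invertible_if_two_large_factors[OF i that(1)] that(2) inv by blast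
    then show ?thesis using factor_if_invertible[OF inv i(1)] i(1) by blast
  next
    case False
    \<comment> \<open>All factors are P_2, so any index can be singled out; \<open>0\<close> is one
      since \<open>1 \<le> k\<close>.\<close>
    then show ?thesis using small factor_if_invertible[OF inv, of 0] k by (intro exI[of _ 0]) auto
  qed
qed

section \<open>Invertibility when all factors but one are P_2\<close>

lemma ecc_matrix_one_large_factor:
  assumes i: "i < k" and two: "\<forall>j<k. j \<noteq> i \<longrightarrow> card (pverts (T j)) = 2"
    and u: "u \<in> pverts G" and v: "v \<in> pverts G"
  shows "ecc_matrix G u v = (if \<forall>j<k. j \<noteq> i \<longrightarrow> u j \<noteq> v j
    then tree_metric.shifted_ecc_matrix (pverts (T i)) (d i) (real (k - 1)) (u i) (v i) else 0)"
proof -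
  interpret i: undirected_tree_graph "T i" using tree_graph i .
  have de: "d j (u j) (v j) = of_bool (u j \<noteq> v j)" "e j (u j) = 1" "e j (v j) = 1"
    if "j < k" "j \<noteq> i" for j
  proof -
    interpret j: undirected_tree_graph "T j" using tree_graph that(1) .
    show "d j (u j) (v j) = of_bool (u j \<noteq> v j)" "e j (u j) = 1" "e j (v j) = 1"
      using j.tm.two_vertices[OF two[rule_format, OF that]] coord[OF u that(1)] coord[OF v that(1)] j.eccentricity_eq
      by auto
  qed
  let ?A = "\<forall>j<k. j \<noteq> i \<longrightarrow> u j \<noteq> v j"
  have split: "(\<forall>j<k. P j) \<longleftrightarrow> P i \<and> (\<forall>j<k. j \<noteq> i \<longrightarrow> P j)" for P using i by metis
  \<comment> \<open>Every vertex of P_2 has eccentricity 1, so both alternatives ask the same of the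
    coordinates other than \<open>i\<close>: that they differ. Each then contributes 1 to the
    distance, which gives the shift \<open>k - 1\<close>.\<close>
  have cond: "(\<forall>j<k. d j (u j) (v j) = e j (u j)) \<longleftrightarrow> d i (u i) (v i) = e i (u i) \<and> ?A"
    "(\<forall>j<k. d j (u j) (v j) = e j (v j)) \<longleftrightarrow> d i (u i) (v i) = e i (v i) \<and> ?A"
    unfolding split[of "\<lambda>j. d j (u j) (v j) = _ j"] using de by auto
  have min: "d i (u i) (v i) = e i (u i) \<or> d i (u i) (v i) = e i (v i) \<longleftrightarrow>
    d i (u i) (v i) = min (i.tm.ecc (u i)) (i.tm.ecc (v i))"
    using d_le_e[OF i coord[OF u i] coord[OF v i]] unfolding i.eccentricity_eq by linarith
  show ?thesis
  proof (cases ?A)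
    case False
    show ?thesis unfolding ecc_matrix_product[OF u v] cond by (simp only: False simp_thms if_False)
  next
    case True
    have "(\<Sum>j<k. d j (u j) (v j)) = d i (u i) (v i) + (\<Sum>j\<in>{..<k} - {i}. 1)"
      unfolding sum_lessThan_remove[OF i] using de(1) True by (intro arg_cong2[of _ _ _ _ "(+)"] sum.cong refl) simp
    also have "\<dots> = d i (u i) (v i) + (k - 1)" using i by simp
    finally have "(\<Sum>j<k. real (d j (u j) (v j))) = real (d i (u i) (v i)) + real (k - 1)"
      by (metis of_nat_add of_nat_sum)
    then show ?thesis
      unfolding ecc_matrix_product[OF u v] cond i.tm.shifted_ecc_matrix_def min[symmetric]
      using True by auto
  qed
qed

text \<open>On the kernel of the eccentricity matrix, the coordinates other than \<open>i\<close> decouple: for an entry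
  of the matrix to be nonzero they have to be antipodal.\<close>

lemma invertible_if_one_large_factor:
  assumes i: "i < k" "is_star (T i) \<or> is_path 4 (T i)"
    and two: "\<forall>j<k. j \<noteq> i \<longrightarrow> card (pverts (T j)) = 2"
  shows "invertible_on (pverts G) (ecc_matrix G)"
  unfolding invertible_on_iff_trivial_kernel[OF finite_pverts]
proof (intro allI impI ballI)
  fix x w assume ker: "\<forall>u\<in>pverts G. (\<Sum>v\<in>pverts G. ecc_matrix G u v * x v) = 0" and w: "w \<in> pverts G"
  interpret i: undirected_tree_graph "T i" using tree_graph i(1) .
  let ?M = "i.tm.shifted_ecc_matrix (real (k - 1))"
  have "\<exists>t\<in>pverts (T j). pverts (T j) = {w j, t} \<and> w j \<noteq> t" if "j < k" "j \<noteq> i" for j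
    using tree_metric.two_vertices(3)[OF tree_metric_gdist[OF trees[OF that(1)]] two[rule_format, OF that] coord[OF w that(1)]] .
  \<comment> \<open>\<open>a j\<close> is the antipode of \<open>w j\<close> in the factor P_2 with
    index \<open>j\<close>.\<close>
  then obtain a where a: "\<And>j. j < k \<Longrightarrow> j \<noteq> i \<Longrightarrow> a j \<in> pverts (T j)"
    "\<And>j. j < k \<Longrightarrow> j \<noteq> i \<Longrightarrow> pverts (T j) = {w j, a j}" "\<And>j. j < k \<Longrightarrow> j \<noteq> i \<Longrightarrow> w j \<noteq> a j"
    by metis
  have row: "(\<Sum>s\<in>pverts (T i). ?M t s * x (w(i := s))) = 0" if t: "t \<in> pverts (T i)" for t
  proof -
    \<comment> \<open>The row of \<open>u\<close> is supported on the line through \<open>w\<close>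
      in direction \<open>i\<close>, since off \<open>i\<close> a column must be antipodal to
      \<open>a\<close>, that is, agree with \<open>w\<close>. Along this line the kernel equation
      becomes the row of \<open>t\<close> in \<open>?M\<close>.\<close>
    define u where "u = (\<lambda>j\<in>{..<k}. if j = i then t else a j)"
    have u: "u \<in> pverts G" unfolding pverts_product u_def using a(1) t by (intro restrict_PiE_iff[THEN iffD2]) auto
    have ui: "u i = t" and uj: "\<And>j. j < k \<Longrightarrow> j \<noteq> i \<Longrightarrow> u j = a j" using i(1) by (simp_all add: u_def)
    have mem: "w(i := s) \<in> pverts G" if "s \<in> pverts (T i)" for s using fun_upd_in_pverts w i(1) that .
    have fib: "v \<in> (\<lambda>s. w(i := s)) ` pverts (T i)"
      if v: "v \<in> pverts G" and "\<forall>j<k. j \<noteq> i \<longrightarrow> u j \<noteq> v j" for v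
    proof -
      have "v j = w j" if "j < k" "j \<noteq> i" for j
        using coord[OF v that(1)] a(2)[OF that] uj[OF that] \<open>\<forall>j<k. j \<noteq> i \<longrightarrow> u j \<noteq> v j\<close> that by auto
      then have "v = w(i := v i)"
        using v mem[OF coord[OF v i(1)]] unfolding pverts_product by (intro PiE_ext) auto
      then show ?thesis using coord[OF v i(1)] by blast
    qed
    have inj: "inj_on (\<lambda>s. w(i := s)) (pverts (T i))" by (rule inj_onI) (metis fun_upd_same)
    have "0 = (\<Sum>v\<in>pverts G. ecc_matrix G u v * x v)" using ker u by simp
    also have "\<dots> = (\<Sum>v\<in>(\<lambda>s. w(i := s)) ` pverts (T i). ecc_matrix G u v * x v)"
    proof (rule sum.mono_neutral_right[OF finite_pverts])
      show "(\<lambda>s. w(i := s)) ` pverts (T i) \<subseteq> pverts G" using mem by blast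
      show "\<forall>v\<in>pverts G - (\<lambda>s. w(i := s)) ` pverts (T i). ecc_matrix G u v * x v = 0"
      proof
        fix v assume v: "v \<in> pverts G - (\<lambda>s. w(i := s)) ` pverts (T i)"
        then have vG: "v \<in> pverts G" and no: "\<not> (\<forall>j<k. j \<noteq> i \<longrightarrow> u j \<noteq> v j)" using fib by blast+
        then have "ecc_matrix G u v = 0"
          unfolding ecc_matrix_one_large_factor[OF i(1) two u vG] by (simp only: no if_False)
        then show "ecc_matrix G u v * x v = 0" by simp
      qed
    qed
    also have "\<dots> = (\<Sum>s\<in>pverts (T i). ecc_matrix G u (w(i := s)) * x (w(i := s)))"
      using sum.reindex[OF inj] by simp
    also have "\<dots> = (\<Sum>s\<in>pverts (T i). ?M t s * x (w(i := s)))"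
    proof (rule sum.cong[OF refl])
      fix s assume s: "s \<in> pverts (T i)"
      have "\<forall>j<k. j \<noteq> i \<longrightarrow> u j \<noteq> (w(i := s)) j" using uj a(3) by fastforce
      then have "ecc_matrix G u (w(i := s)) = ?M t s"
        unfolding ecc_matrix_one_large_factor[OF i(1) two u mem[OF s]] using ui by simp
      then show "ecc_matrix G u (w(i := s)) * x (w(i := s)) = ?M t s * x (w(i := s))" by simp
    qed
    finally show ?thesis ..
  qed
  have "x (w(i := s)) = 0" if s: "s \<in> pverts (T i)" for s
  proof (cases "is_star (T i)")
    case True
    then obtain c where c: "c \<in> pverts (T i)" "\<And>v. v \<in> pverts (T i) - {c} \<Longrightarrow> d i c v = 1"
      using i.is_star_iff[OF card_ge_2[OF i(1)]] by blast
    show ?thesis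
      using i.tm.star_kernel_trivial[OF c card_ge_2[OF i(1)] _ row s] by simp
  next
    case False
    then obtain a b c e where "pverts (T i) = {a, b, c, e}" "distinct [a, b, c, e]"
      "d i a b = 1" "d i b c = 1" "d i c e = 1" "d i a e = 3"
      using i(2) i.is_path_4_iff by blast
    then show ?thesis using i.tm.path_4_kernel_trivial[OF _ _ _ _ _ _ _ row s] by simp
  qed
  then have "x (w(i := w i)) = 0" using coord[OF w i(1)] by blast
  then show "x w = 0" by simp
qed

end

theorem theorem7:
  fixes k :: nat and T :: "nat \<Rightarrow> 'a pair_pre_digraph"
  assumes "1 \<le> k"
    and "\<And>i. i < k \<Longrightarrow> undirected_tree (T i)"
    and "\<And>i. i < k \<Longrightarrow> 2 \<le> card (pverts (T i))"
  shows "invertible_on (pverts (cartesian_product k T)) (ecc_matrix (cartesian_product k T)) \<longleftrightarrow>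
    (\<exists>i<k. (is_star (T i) \<or> is_path 4 (T i)) \<and> (\<forall>j<k. j \<noteq> i \<longrightarrow> is_path 2 (T j)))"
proof -
  interpret tree_product k T using assms(2,3) by unfold_locales
  have "is_path 2 (T j) \<longleftrightarrow> card (pverts (T j)) = 2" if "j < k" for j
    using undirected_tree_graph.is_path_2_iff[OF tree_graph[OF that]] .
  then show ?thesis
    using factors_if_invertible[OF _ assms(1)] invertible_if_one_large_factor by blast
qed

end
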